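(* Let $d\in\mathbb{N}$, $s>d/2$ and $0<r\le\infty$. Then $$\lim_{n\to\infty}n^{s/d-1/2}\,a_n\big(I_d:H^{s,r}(\mathbb{T}^d)\to L_\infty(\mathbb{T}^d)\big)=\sqrt{\frac{d}{2s-d}}\;\mathrm{vol}(B_r^d)^{s/d},$$ where $B_r^d=\{x\in\mathbb{R}^d:|x|_r\le 1\}$ and $\mathrm{vol}$ is Lebesgue measure on $\mathbb{R}^d$.
   Context: $\mathbb{T}^d=[0,2\pi)^d$ is the $d$-dimensional torus with the normalized Lebesgue measure $(2\pi)^{-d}dx$. For $f\in L_1(\mathbb{T}^d)$, $\hat f(k)=(2\pi)^{-d}\int_{\mathbb{T}^d}f(x)e^{-ik\cdot x}dx$. For $x\in\mathbb{R}^d$, $|x|_r=(\sum_{j=1}^d|x_j|^r)^{1/r}$ for $0<r<\infty$ and $|x|_\infty=\max_j|x_j|$. For $s>0$, $0<r\le\infty$, the isotropic Sobolev space $H^{s,r}(\mathbb{T}^d)$ consists of all $f\in L_2(\mathbb{T}^d)$ with finite norm $\|f|H^{s,r}(\mathbb{T}^d)\|=\big(\sum_{k\in\mathbb{Z}^d}(1+\sum_{j=1}^d|k_j|^r)^{2s/r}|\hat f(k)|^2\big)^{1/2}$, where for $r=\infty$ the weight $(1+\sum_j|k_j|^r)^{s/r}$ is interpreted as $\max(1,|k|_\infty)^s$. $I_d$ is the inclusion map. For a bounded linear operator $T:X\to Y$ between Banach spaces, $a_n(T)=\inf\{\|T-A\|: A:X\to Y \text{ bounded linear},\ \operatorname{rank}A<n\}$.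 *)

theory Defs
  imports "HOL-Analysis.Analysis" "HOL-Probability.Essential_Supremum"
begin

definition torus :: "(real ^ 'd) set" where
  "torus = {x. \<forall>i. 0 \<le> x $ i \<and> x $ i < 2 * pi}"

definition fourier_coeff :: "(real ^ 'd \<Rightarrow> complex) \<Rightarrow> int ^ 'd \<Rightarrow> complex" where
  "fourier_coeff f k = complex_of_real (1 / (2 * pi) ^ CARD('d)) *
     (LINT x | lebesgue_on (torus :: (real ^ 'd) set).
        f x * exp (- \<i> * complex_of_real (\<Sum>j\<in>UNIV. real_of_int (k $ j) * x $ j)))"

definition L2_torus :: "(real ^ 'd \<Rightarrow> complex) set" where
  "L2_torus = {f. f \<in> borel_measurable (lebesgue_on torus) \<and>
                  integrable (lebesgue_on torus) (\<lambda>x. (cmod (f x))\<^sup>2)}"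

definition sob_weight :: "real \<Rightarrow> ereal \<Rightarrow> int ^ 'd \<Rightarrow> real" where
  "sob_weight s r k = (if r = \<infinity> then (max 1 (Max (range (\<lambda>j. real_of_int \<bar>k $ j\<bar>)))) powr s
      else (1 + (\<Sum>j\<in>UNIV. real_of_int \<bar>k $ j\<bar> powr real_of_ereal r)) powr (s / real_of_ereal r))"

definition sob_terms :: "real \<Rightarrow> ereal \<Rightarrow> (real ^ 'd \<Rightarrow> complex) \<Rightarrow> int ^ 'd \<Rightarrow> real" where
  "sob_terms s r f k = (sob_weight s r k)\<^sup>2 * (cmod (fourier_coeff f k))\<^sup>2"

definition H_space :: "real \<Rightarrow> ereal \<Rightarrow> (real ^ 'd \<Rightarrow> complex) set" where
  "H_space s r = {f. f \<in> L2_torus \<and> sob_terms s r f summable_on UNIV}"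

definition H_norm :: "real \<Rightarrow> ereal \<Rightarrow> (real ^ 'd \<Rightarrow> complex) \<Rightarrow> real" where
  "H_norm s r f = sqrt (\<Sum>\<^sub>\<infinity>k. sob_terms s r f k)"

definition Linf_norm :: "(real ^ 'd \<Rightarrow> complex) \<Rightarrow> ereal" where
  "Linf_norm g = esssup (lebesgue_on (torus :: (real ^ 'd) set)) (\<lambda>x. ereal (cmod (g x)))"

definition Linf_torus :: "(real ^ 'd \<Rightarrow> complex) set" where
  "Linf_torus = {g. g \<in> borel_measurable (lebesgue_on torus) \<and> Linf_norm g < \<infinity>}"

text \<open>Bounded linear operators A : H^{s,r} -> L_infinity (elements of L_infinity are
  identified when equal almost everywhere) with rank < n.\<close>
definition admissible_op ::
  "real \<Rightarrow> ereal \<Rightarrow> nat \<Rightarrow> ((real ^ 'd \<Rightarrow> complex) \<Rightarrow> (real ^ 'd \<Rightarrow> complex)) \<Rightarrow> bool" where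
  "admissible_op s r n A \<longleftrightarrow>
     (\<forall>f\<in>H_space s r. A f \<in> Linf_torus) \<and>
     (\<forall>f\<in>H_space s r. \<forall>g\<in>H_space s r. \<forall>a b :: complex.
        AE x in lebesgue_on torus. A (\<lambda>y. a * f y + b * g y) x = a * A f x + b * A g x) \<and>
     (\<exists>C::real. \<forall>f\<in>H_space s r. Linf_norm (A f) \<le> ereal (C * H_norm s r f)) \<and>
     (\<exists>m<n. \<exists>G :: nat \<Rightarrow> (real ^ 'd \<Rightarrow> complex). (\<forall>j<m. G j \<in> Linf_torus) \<and>
        (\<forall>f\<in>H_space s r. \<exists>c :: nat \<Rightarrow> complex.
           AE x in lebesgue_on torus. A f x = (\<Sum>j<m. c j * G j x)))"

definition diff_op_norm ::
  "real \<Rightarrow> ereal \<Rightarrow> ((real ^ 'd \<Rightarrow> complex) \<Rightarrow> (real ^ 'd \<Rightarrow> complex)) \<Rightarrow> ereal" where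
  "diff_op_norm s r A =
     (SUP f\<in>{f \<in> H_space s r. H_norm s r f \<le> 1}. Linf_norm (\<lambda>x. f x - A f x))"

definition approx_num :: "'d::finite itself \<Rightarrow> real \<Rightarrow> ereal \<Rightarrow> nat \<Rightarrow> ereal" where
  "approx_num _ s r n =
     (INF A\<in>{A :: (real ^ 'd \<Rightarrow> complex) \<Rightarrow> (real ^ 'd \<Rightarrow> complex). admissible_op s r n A}.
        diff_op_norm s r A)"

definition unit_ball_r :: "ereal \<Rightarrow> (real ^ 'd) set" where
  "unit_ball_r r = (if r = \<infinity> then {x. \<forall>j. \<bar>x $ j\<bar> \<le> 1}
      else {x. (\<Sum>j\<in>UNIV. \<bar>x $ j\<bar> powr real_of_ereal r) powr (1 / real_of_ereal r) \<le> 1})"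

end

theory Submission
  imports Defs "HOL-Real_Asymp.Real_Asymp"
begin

text \<open>
  Order the frequencies as \<open>e\<close> by increasing weight and let \<open>\<sigma> j\<close> be the reciprocal weight of
  \<open>e j\<close>. Then the approximation number with index \<open>n + 1\<close> is exactly the square root of the tail sum
  of \<open>(\<sigma> j)\<^sup>2\<close> over \<open>j \<ge> n\<close>. For the upper bound, truncate the Fourier series after \<open>n\<close> terms
  and apply Cauchy--Schwarz to the remainder. For the lower bound, let \<open>u k\<close> be the normalised
  characters and \<open>T = I - A\<close> with \<open>\<parallel>T\<parallel> \<le> D\<close>; since the target norm is a supremum norm,
  \<open>\<Sum>k. \<bar>T (u k) x\<bar>\<^sup>2 \<le> D\<^sup>2\<close> holds for almost every \<open>x\<close>. Integrating over the torus bounds a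
  Hilbert--Schmidt norm by \<open>D\<close>, and the Hilbert--Schmidt distance of a diagonal operator to the
  operators of rank at most \<open>n\<close> is that same tail. Finally, counting lattice points gives
  \<open>\<sigma> j \<sim> (vol / j) powr (s / d)\<close>, from which the limit of the tails is read off.
\<close>

section \<open>Tail sums and sorted enumerations\<close>

text \<open>The two bounds coincide because every character has modulus 1: the sum of
  \<open>\<bar>u k x\<bar>^2\<close> is the same at every \<open>x\<close>, so replacing a supremum
  over \<open>x\<close> by the average over the torus loses nothing. The constant comes from the
  tail of a power series of exponent p = 2s/d: the sum of (V/j)^p over j >= n behaves like V^p
  n^(1-p) / (p-1), and 1/(p-1) = d/(2s-d). The condition s > d/2 says exactly p > 1. Two obstacles
  shape the rest. An operator is linear only up to null sets that depend on the functions combined,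
  so pointwise statements are restricted to finitely many basis functions and countably many
  coefficients. The Hilbert-Schmidt argument is therefore carried out on N x N matrices of Fourier
  coefficients, with N unbounded only at the very end. On the other side, truncating a Fourier
  series says something about \<open>f\<close> itself only if \<open>f\<close> equals its series
  almost everywhere; that is what the uniqueness theorem for Fourier coefficients supplies.\<close>

text \<open>From some index on, \<open>a j\<close> differs from \<open>c * b j\<close> by at most
  \<epsilon> times \<open>b j\<close>; summing keeps the relative error, so tails inherit the ratio
  of the terms. Convergence of \<open>a\<close> follows by comparison with \<open>b\<close>.\<close>

lemma tail_sum_asymptotic:
  fixes a b B :: "nat \<Rightarrow> real"
  assumes lim: "(\<lambda>j. a j / b j) \<longlonglongrightarrow> c"
    and pos: "eventually (\<lambda>j. b j > 0) sequentially"
    and sums: "\<And>n. (\<lambda>j. b (j + n)) sums B n"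
  shows "summable a" and "(\<lambda>n. (\<Sum>j. a (j + n)) / B n) \<longlonglongrightarrow> c"
proof -
  have est: "eventually (\<lambda>n. summable a \<and> \<bar>(\<Sum>j. a (j + n)) / B n - c\<bar> \<le> \<epsilon>) sequentially"
    if e: "\<epsilon> > 0" for \<epsilon>
  proof -
    have "eventually (\<lambda>j. \<bar>a j / b j - c\<bar> < \<epsilon>) sequentially"
      using lim e by (auto simp: tendsto_iff dist_real_def)
    with pos have "eventually (\<lambda>j. b j > 0 \<and> \<bar>a j - c * b j\<bar> \<le> \<epsilon> * b j) sequentially"
    proof eventually_elim
      case (elim j)
      have "a j - c * b j = (a j / b j - c) * b j" using elim by (simp add: field_simps)
      then show ?case using elim by (simp add: abs_mult)
    qed
    then obtain M where M: "\<And>j. j \<ge> M \<Longrightarrow> b j > 0 \<and> \<bar>a j - c * b j\<bar> \<le> \<epsilon> * b j"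
      by (auto simp: eventually_sequentially)
    have "summable a \<and> \<bar>(\<Sum>j. a (j + n)) / B n - c\<bar> \<le> \<epsilon>" if n: "n \<ge> M" for n
    proof -
      have sb: "summable (\<lambda>j. b (j + n))" and Bn: "B n = (\<Sum>j. b (j + n))"
        using sums[of n] by (auto simp: sums_iff)
      have "B n > 0" unfolding Bn using M n by (intro suminf_pos sb) auto
      define d where "d = (\<lambda>j. a (j + n) - c * b (j + n))"
      have db: "\<bar>d j\<bar> \<le> \<epsilon> * b (j + n)" for j using M[of "j + n"] n by (simp add: d_def)
      have sd: "summable (\<lambda>j. \<bar>d j\<bar>)"
        by (rule summable_comparison_test'[where g = "\<lambda>j. \<epsilon> * b (j + n)" and N = 0])
          (use db sb in \<open>auto intro: summable_mult\<close>)
      have sd': "summable d" using sd by (rule summable_rabs_cancel)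
      have "summable (\<lambda>j. d j + c * b (j + n))" by (intro summable_add sd' summable_mult sb)
      then have sa: "summable (\<lambda>j. a (j + n))" by (simp add: d_def)
      have "\<bar>suminf d\<bar> \<le> (\<Sum>j. \<bar>d j\<bar>)" by (rule summable_rabs[OF sd])
      also have "\<dots> \<le> (\<Sum>j. \<epsilon> * b (j + n))" by (intro suminf_le db sd summable_mult sb)
      also have "\<dots> = \<epsilon> * B n" unfolding Bn by (rule suminf_mult[OF sb])
      finally have "\<bar>suminf d\<bar> \<le> \<epsilon> * B n" .
      moreover have "suminf d = (\<Sum>j. a (j + n)) - c * B n"
        using suminf_diff[OF sa summable_mult[OF sb, of c]] suminf_mult[OF sb, of c]
        by (simp add: d_def Bn)
      ultimately have "\<bar>(\<Sum>j. a (j + n)) - c * B n\<bar> \<le> \<epsilon> * B n" by simp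
      moreover have "(\<Sum>j. a (j + n)) / B n - c = ((\<Sum>j. a (j + n)) - c * B n) / B n"
        using \<open>B n > 0\<close> by (simp add: field_simps)
      ultimately have "\<bar>(\<Sum>j. a (j + n)) / B n - c\<bar> \<le> \<epsilon>" using \<open>B n > 0\<close> by (simp add: field_simps)
      with sa show ?thesis by (simp add: summable_iff_shift)
    qed
    then show ?thesis by (auto simp: eventually_sequentially)
  qed
  show "summable a" using est[of 1] by (auto simp: eventually_sequentially)
  show "(\<lambda>n. (\<Sum>j. a (j + n)) / B n) \<longlonglongrightarrow> c"
  proof (rule tendstoI)
    fix e :: real assume "e > 0"
    then show "eventually (\<lambda>n. dist ((\<Sum>j. a (j + n)) / B n) c < e) sequentially"
      using est[of "e/2"] by (auto elim!: eventually_mono simp: dist_real_def)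
  qed
qed

text \<open>Comparison with \<open>j powr (1 - p) - (j + 1) powr (1 - p)\<close>, whose tails telescope.\<close>

lemma power_tail_sum_asymptotic:
  fixes a :: "nat \<Rightarrow> real" and p c :: real
  assumes p: "p > 1" and lim: "(\<lambda>j. a j * real j powr p) \<longlonglongrightarrow> c"
  shows "summable a" and "(\<lambda>n. real n powr (p - 1) * (\<Sum>j. a (j + n))) \<longlonglongrightarrow> c / (p - 1)"
proof -
  define b where "b = (\<lambda>j. real j powr (1 - p) - real (Suc j) powr (1 - p))"
  \<comment> \<open>By the mean value theorem \<open>b j\<close> behaves like (p - 1) j^(-p); this
    is the origin of the divisor \<open>p - 1\<close>.\<close>
  have bl: "(\<lambda>j. b j * real j powr p) \<longlonglongrightarrow> p - 1"
    unfolding b_def using p by real_asymp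
  have "eventually (\<lambda>j. b j * real j powr p > 0) sequentially"
    using order_tendstoD(1)[OF bl, of 0] p by simp
  then have pos: "eventually (\<lambda>j. b j > 0) sequentially"
    by eventually_elim (metis mult_le_0_iff not_less powr_ge_zero)
  have z: "(\<lambda>j. real j powr (1 - p)) \<longlonglongrightarrow> 0" using p by real_asymp
  \<comment> \<open>This includes n = 0: \<open>real 0 powr (1 - p)\<close> is 0, so
    \<open>b 0\<close> is -1 and the telescoped total is 0. For that reason \<open>b\<close> is
    positive only eventually.\<close>
  have sums: "(\<lambda>j. b (j + n)) sums (real n powr (1 - p))" for n
    using telescope_sums'[OF LIMSEQ_ignore_initial_segment[OF z, of n]] by (simp add: b_def)
  have "(\<lambda>j. (a j * real j powr p) / (b j * real j powr p)) \<longlonglongrightarrow> c / (p - 1)"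
    using p by (intro tendsto_divide lim bl) auto
  moreover have "eventually (\<lambda>j. (a j * real j powr p) / (b j * real j powr p) = a j / b j) sequentially"
    using eventually_gt_at_top[of 0] by eventually_elim simp
  ultimately have l: "(\<lambda>j. a j / b j) \<longlonglongrightarrow> c / (p - 1)" by (rule Lim_transform_eventually)
  show "summable a" by (rule tail_sum_asymptotic(1)[OF l pos sums])
  have "(\<lambda>n. (\<Sum>j. a (j + n)) / real n powr (1 - p)) \<longlonglongrightarrow> c / (p - 1)"
    by (rule tail_sum_asymptotic(2)[OF l pos sums])
  moreover have "(\<Sum>j. a (j + n)) / real n powr (1 - p) = real n powr (p - 1) * (\<Sum>j. a (j + n))" for n
    using powr_minus[of "real n" "1 - p"] by (simp add: field_simps)
  ultimately show "(\<lambda>n. real n powr (p - 1) * (\<Sum>j. a (j + n))) \<longlonglongrightarrow> c / (p - 1)" by simp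
qed

text \<open>Greedy choice: always pick an element of least weight among those left. Finite sublevel
  sets make the minimum exist. They also force every \<open>k\<close> to be reached, since otherwise
  infinitely many picks would have weight at most \<open>w k\<close>.\<close>

lemma exists_sorted_enumeration:
  fixes w :: "'a \<Rightarrow> real"
  assumes inf: "infinite (UNIV :: 'a set)" and fin: "\<And>t. finite {k. w k \<le> t}"
  obtains e :: "nat \<Rightarrow> 'a" where "bij e" "incseq (\<lambda>j. w (e j))"
proof -
  have ex: "\<exists>k. k \<notin> S \<and> (\<forall>l. l \<notin> S \<longrightarrow> w k \<le> w l)" if "finite S" for S
  proof -
    obtain k0 where k0: "k0 \<notin> S" using inf \<open>finite S\<close> ex_new_if_finite by blast
    define T where "T = {k. w k \<le> w k0} - S"
    have "finite T" "k0 \<in> T" using fin k0 by (auto simp: T_def)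
    then obtain k where k: "k \<in> T" "\<And>l. l \<in> T \<Longrightarrow> w k \<le> w l"
      using arg_min_if_finite(1)[of T w] arg_min_least[of T _ w] by blast
    have "w k \<le> w l" if "l \<notin> S" for l
    proof (cases "w l \<le> w k0")
      case True then show ?thesis using k(2)[of l] that by (simp add: T_def)
    next
      case False then show ?thesis using k(2)[OF \<open>k0 \<in> T\<close>] by simp
    qed
    then show ?thesis using k(1) by (auto simp: T_def)
  qed
  define pick where "pick S = (SOME k. k \<notin> S \<and> (\<forall>l. l \<notin> S \<longrightarrow> w k \<le> w l))" for S
  have pick: "pick S \<notin> S" "\<And>l. l \<notin> S \<Longrightarrow> w (pick S) \<le> w l" if "finite S" for S
    using someI_ex[OF ex[OF that]] unfolding pick_def by blast+
  define S where "S = rec_nat {} (\<lambda>_ S. insert (pick S) S)"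
  have S0: "S 0 = {}" and SS: "S (Suc n) = insert (pick (S n)) (S n)" for n
    by (auto simp: S_def)
  have finS: "finite (S n)" for n by (induction n) (auto simp: S0 SS)
  define e where "e n = pick (S n)" for n
  have S_eq: "S n = e ` {..<n}" for n
    by (induction n) (auto simp: S0 SS e_def lessThan_Suc)
  have ne: "e n \<notin> e ` {..<n}" and mn: "l \<notin> e ` {..<n} \<Longrightarrow> w (e n) \<le> w l" for n l
    using pick(1)[OF finS[of n]] pick(2)[OF finS[of n], of l] unfolding S_eq[symmetric] by (simp_all add: e_def)
  have "inj e"
  proof (rule injI)
    fix i j assume "e i = e j"
    then have "\<not> i < j" "\<not> j < i" using ne[of i] ne[of j] by (metis imageI lessThan_iff)+
    then show "i = j" by simp
  qed
  have "k \<in> range e" for k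
  proof (rule ccontr)
    assume "k \<notin> range e"
    then have "range e \<subseteq> {l. w l \<le> w k}" using mn by blast
    then have "finite (range e)" using fin finite_subset by blast
    then show False using \<open>inj e\<close> finite_imageD by blast
  qed
  then have "bij e" using \<open>inj e\<close> by (auto simp: bij_def)
  moreover have "incseq (\<lambda>j. w (e j))"
  proof (rule incseq_SucI)
    fix n show "w (e n) \<le> w (e (Suc n))" using ne[of "Suc n"] by (intro mn) auto
  qed
  ultimately show ?thesis using that by blast
qed

section \<open>Counting lattice points\<close>

text \<open>The half-open cube of side 1/t lies between an open and a closed box of the same
  volume.\<close>

lemma emeasure_lattice_cube:
  fixes k :: "int ^ 'd" and t :: real
  assumes t: "t > 0"
  defines "Q \<equiv> {x :: real ^ 'd. (\<chi> i. \<lfloor>t * x $ i\<rfloor>) = k}"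
  shows "Q \<in> sets lborel" and "emeasure lborel Q = ennreal (1 / t ^ CARD('d))"
proof -
  have Q_eq: "Q = {x. \<forall>i. of_int (k $ i) \<le> t * x $ i \<and> t * x $ i < of_int (k $ i) + 1}"
    by (auto simp: Q_def vec_eq_iff floor_eq_iff)
  have "{x :: real ^ 'd. \<forall>i. of_int (k $ i) \<le> t * x $ i \<and> t * x $ i < of_int (k $ i) + 1} \<in> sets borel"
    by measurable
  then show Qs: "Q \<in> sets lborel" unfolding Q_eq by simp
  define a b :: "real ^ 'd" where "a = (\<chi> i. of_int (k $ i) / t)" and "b = (\<chi> i. (of_int (k $ i) + 1) / t)"
  have ab: "a $ i \<le> b $ i" for i using t by (simp add: a_def b_def divide_right_mono)
  have ab': "b $ i - a $ i = 1 / t" for i by (simp add: a_def b_def diff_divide_distrib[symmetric])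
  have "box a b \<subseteq> Q"
    using t by (auto simp: mem_box_cart a_def b_def Q_eq field_simps intro: less_imp_le)
  moreover have "Q \<subseteq> cbox a b"
    using t by (auto simp: mem_box_cart a_def b_def Q_eq pos_divide_le_eq pos_le_divide_eq mult.commute[of _ t])
      (meson less_imp_le)
  ultimately have "emeasure lborel (box a b) \<le> emeasure lborel Q" "emeasure lborel Q \<le> emeasure lborel (cbox a b)"
    using Qs by (auto intro!: emeasure_mono)
  moreover have "emeasure lborel (cbox a b) = ennreal (1 / t ^ CARD('d))"
  proof -
    have "measure lborel (cbox a b) = (\<Prod>i\<in>UNIV. b $ i - a $ i)"
      using ab by (intro content_cbox_cart) (auto simp: interval_ne_empty_cart)
    also have "\<dots> = 1 / t ^ CARD('d)" by (simp add: ab' power_divide)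
    finally show ?thesis
      by (metis emeasure_eq_ennreal_measure emeasure_lborel_cbox_finite less_irrefl infinity_ennreal_def)
  qed
  moreover have "emeasure lborel (box a b) = emeasure lborel (cbox a b)"
    by (simp add: emeasure_lborel_box_eq emeasure_lborel_cbox_eq)
  ultimately show "emeasure lborel Q = ennreal (1 / t ^ CARD('d))" by simp
qed

lemma finite_lattice_box:
  "finite {k :: int ^ 'd. \<forall>i. real_of_int \<bar>k $ i\<bar> \<le> t}"
proof -
  have "finite {k :: int ^ 'd. \<forall>i. k $ i \<in> {-\<lceil>t\<rceil>..\<lceil>t\<rceil>}}"
  proof (rule finite_surj[where f = vec_lambda])
    show "finite (UNIV \<rightarrow>\<^sub>E {-\<lceil>t\<rceil>..\<lceil>t\<rceil>} :: ('d \<Rightarrow> int) set)" by (intro finite_PiE) auto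
    show "{k :: int ^ 'd. \<forall>i. k $ i \<in> {-\<lceil>t\<rceil>..\<lceil>t\<rceil>}} \<subseteq> vec_lambda ` (UNIV \<rightarrow>\<^sub>E {-\<lceil>t\<rceil>..\<lceil>t\<rceil>})"
    proof
      fix k :: "int ^ 'd" assume "k \<in> {k. \<forall>i. k $ i \<in> {-\<lceil>t\<rceil>..\<lceil>t\<rceil>}}"
      then have "vec_nth k \<in> UNIV \<rightarrow>\<^sub>E {-\<lceil>t\<rceil>..\<lceil>t\<rceil>}" by auto
      then show "k \<in> vec_lambda ` (UNIV \<rightarrow>\<^sub>E {-\<lceil>t\<rceil>..\<lceil>t\<rceil>})"
        by (intro image_eqI[of _ _ "vec_nth k"]) simp_all
    qed
  qed
  moreover have "{k :: int ^ 'd. \<forall>i. real_of_int \<bar>k $ i\<bar> \<le> t} \<subseteq> {k. \<forall>i. k $ i \<in> {-\<lceil>t\<rceil>..\<lceil>t\<rceil>}}"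
  proof clarify
    fix k :: "int ^ 'd" and i assume "\<forall>i. real_of_int \<bar>k $ i\<bar> \<le> t"
    then have "real_of_int \<bar>k $ i\<bar> \<le> t" ..
    then show "k $ i \<in> {-\<lceil>t\<rceil>..\<lceil>t\<rceil>}" unfolding atLeastAtMost_iff by linarith
  qed
  ultimately show ?thesis by (rule rev_finite_subset)
qed

text \<open>Each lattice point stands for a cube of side \<open>1 / t\<close>, so the normalised count is the integral
  of the indicator evaluated at the integer part of \<open>t x\<close>; dominated convergence replaces any estimate
  of boundary effects and does not need convexity, which fails for \<open>r < 1\<close>.\<close>

lemma lattice_point_count:
  fixes \<psi> :: "int ^ 'd \<Rightarrow> real" and \<phi> :: "real ^ 'd \<Rightarrow> real" and t :: "nat \<Rightarrow> real"
  assumes t: "filterlim t at_top sequentially" and t1: "\<And>n. t n \<ge> 1"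
    and dom: "\<And>k i. real_of_int \<bar>k $ i\<bar> \<le> \<psi> k"
    and lim: "\<And>x. (\<lambda>n. \<psi> (\<chi> i. \<lfloor>t n * x $ i\<rfloor>) / t n) \<longlonglongrightarrow> \<phi> x"
    and cont: "continuous_on UNIV \<phi>"
    and null: "negligible {x. \<phi> x = 1}"
    and A: "\<And>n. {k. \<psi> k < t n} \<subseteq> A n" "\<And>n. A n \<subseteq> {k. \<psi> k \<le> t n}"
  shows "(\<lambda>n. real (card (A n)) / t n ^ CARD('d)) \<longlonglongrightarrow> measure lborel {x. \<phi> x \<le> 1}"
proof -
  define fl where "fl n x = (\<chi> i. \<lfloor>t n * x $ i\<rfloor>)" for n and x :: "real ^ 'd"
  define Q where "Q n k = {x. fl n x = k}" for n k
  have tpos: "t n > 0" for n using t1[of n] by simp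
  have Q: "Q n k \<in> sets lborel" "emeasure lborel (Q n k) = ennreal (1 / t n ^ CARD('d))" for n k
    using emeasure_lattice_cube[OF tpos, of n k] by (auto simp: Q_def fl_def)
  have mQ: "measure lborel (Q n k) = 1 / t n ^ CARD('d)" for n k
    using tpos[of n] by (simp add: measure_def Q)
  have finA: "finite (A n)" for n
  proof (rule finite_subset[OF _ finite_lattice_box[of "t n"]])
    show "A n \<subseteq> {k. \<forall>i. real_of_int \<bar>k $ i\<bar> \<le> t n}"
      using A(2)[of n] by (auto intro!: order_trans[OF dom[unfolded of_int_abs]])
  qed
  define g :: "nat \<Rightarrow> real ^ 'd \<Rightarrow> real" where "g n x = (\<Sum>k\<in>A n. indicator (Q n k) x)" for n x
  have g_eq: "g n x = indicator {x. fl n x \<in> A n} x" for n x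
  proof -
    have "g n x = (\<Sum>k\<in>A n. if k = fl n x then 1 else 0)"
      unfolding g_def by (intro sum.cong) (auto simp: Q_def indicator_def)
    then show ?thesis using finA by (simp add: indicator_def)
  qed
  have gi: "(LINT x|lborel. g n x) = real (card (A n)) / t n ^ CARD('d)" for n
  proof -
    have "(LINT x|lborel. g n x) = (\<Sum>k\<in>A n. LINT x|lborel. indicator (Q n k) x)"
      unfolding g_def using Q by (intro Bochner_Integration.integral_sum) (auto simp: less_top[symmetric])
    then show ?thesis by (simp add: mQ)
  qed
  have [measurable]: "\<phi> \<in> borel_measurable borel" using cont by (rule borel_measurable_continuous_onI)
  have meas: "{x. \<phi> x \<le> 1} \<in> sets lborel" by measurable
  \<comment> \<open>Where \<phi> equals 1 the scaled weight may approach 1 from either side, and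
    \<open>A n\<close> may split ties arbitrarily, so \<open>g n x\<close> need not converge
    there.\<close>
  have "AE x in lebesgue. \<phi> x \<noteq> 1"
    using null by (simp add: negligible_iff_null_sets AE_iff_null)
  then have ae: "AE x in lborel. \<phi> x \<noteq> 1" by (simp add: AE_completion_iff)
  have "(\<lambda>n. LINT x|lborel. g n x) \<longlonglongrightarrow> (LINT x|lborel. indicator {x. \<phi> x \<le> 1} x :: real)"
  proof (rule integral_dominated_convergence)
    show "(indicator {x. \<phi> x \<le> 1} :: _ \<Rightarrow> real) \<in> borel_measurable lborel" using meas by simp
    show "g n \<in> borel_measurable lborel" for n unfolding g_def[abs_def] using Q by measurable
    \<comment> \<open>The cube [-2,2]^d dominates all \<open>g n\<close>: a counted floor has
      modulus at most \<open>t n\<close>, so the modulus of \<open>t n * x $ i\<close> is at most t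
      n + 1, hence at most 2 t n because t n is at least 1.\<close>
    show "integrable lborel (indicator (cbox (\<chi> i. -2) (\<chi> i. 2) :: (real ^ 'd) set) :: (real ^ 'd) \<Rightarrow> real)"
      by (simp add: emeasure_lborel_cbox_eq)
    show "AE x in lborel. norm (g n x) \<le> indicator (cbox (\<chi> i. -2) (\<chi> i. 2)) x" for n
    proof (rule AE_I2)
      fix x :: "real ^ 'd"
      show "norm (g n x) \<le> indicator (cbox (\<chi> i. -2) (\<chi> i. 2)) x"
      proof (cases "fl n x \<in> A n")
        case True
        have "-2 \<le> x $ i \<and> x $ i \<le> 2" for i
        proof -
          have "real_of_int \<bar>\<lfloor>t n * x $ i\<rfloor>\<bar> \<le> t n"
            using True A(2)[of n] dom[of "fl n x" i] by (auto simp: fl_def)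
          then have "\<bar>t n * x $ i\<bar> \<le> t n * 2" using t1[of n] by linarith
          then have "t n * \<bar>x $ i\<bar> \<le> t n * 2" using tpos[of n] by (simp add: abs_mult)
          then show ?thesis using tpos[of n] by (simp add: abs_le_iff)
        qed
        then show ?thesis by (simp add: g_eq mem_box_cart indicator_def)
      qed (simp add: g_eq)
    qed
    show "AE x in lborel. (\<lambda>n. g n x) \<longlonglongrightarrow> indicator {x. \<phi> x \<le> 1} x"
      using ae
    proof eventually_elim
      case (elim x)
      have l: "(\<lambda>n. \<psi> (fl n x) / t n) \<longlonglongrightarrow> \<phi> x" using lim[of x] by (simp add: fl_def)
      have "eventually (\<lambda>n. g n x = indicator {x. \<phi> x \<le> 1} x) sequentially"
      proof (cases "\<phi> x < 1")
        case True
        have "eventually (\<lambda>n. \<psi> (fl n x) / t n < 1) sequentially" using order_tendstoD(2)[OF l True] .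
        then show ?thesis
        proof eventually_elim
          case (elim n)
          then have "fl n x \<in> A n" using A(1)[of n] tpos[of n] by auto
          then show ?case using True by (simp add: g_eq)
        qed
      next
        case False
        with elim have gt: "\<phi> x > 1" by simp
        have "eventually (\<lambda>n. \<psi> (fl n x) / t n > 1) sequentially" using order_tendstoD(1)[OF l gt] .
        then show ?thesis
        proof eventually_elim
          case (elim n)
          then have "fl n x \<notin> A n" using A(2)[of n] tpos[of n] by auto
          then show ?case using gt by (simp add: g_eq)
        qed
      qed
      then show ?case by (rule tendsto_eventually)
    qed
  qed
  then show ?thesis using meas by (simp add: gi)
qed

section \<open>The Sobolev weights\<close>

text \<open>The gauge of \<open>unit_ball_r r\<close>. For r < 1 it violates the triangle
  inequality; positive homogeneity and continuity are what the counting argument draws on. At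
  infinity it is \<open>infnorm\<close>, whose scaling and continuity are already available.\<close>

definition quasinorm :: "ereal \<Rightarrow> real ^ 'd \<Rightarrow> real" where
  "quasinorm r x = (if r = \<infinity> then infnorm x
      else (\<Sum>j\<in>UNIV. \<bar>x $ j\<bar> powr real_of_ereal r) powr (1 / real_of_ereal r))"

lemma pos_ereal_cases:
  assumes "0 < (r :: ereal)"
  obtains "r = \<infinity>" | \<rho> where "r = ereal \<rho>" "\<rho> > 0"
  using assms by (cases r) auto

lemma infnorm_eq_Max_cart: "infnorm (x :: real ^ 'd) = Max (range (\<lambda>j. \<bar>x $ j\<bar>))"
proof -
  have "{\<bar>x $ i\<bar> |i. i \<in> UNIV} = range (\<lambda>j. \<bar>x $ j\<bar>)" by auto
  then show ?thesis by (simp add: infnorm_cart cSup_eq_Max)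
qed

lemma unit_ball_r_eq: "unit_ball_r r = {x :: real ^ 'd. quasinorm r x \<le> 1}"
  by (auto simp: unit_ball_r_def quasinorm_def infnorm_eq_Max_cart)

lemma quasinorm_scaleR:
  fixes x :: "real ^ 'd"
  assumes "0 < r" "c \<ge> 0"
  shows "quasinorm r (c *\<^sub>R x) = c * quasinorm r x"
  using assms(1)
proof (cases rule: pos_ereal_cases)
  case 1 then show ?thesis using assms(2) by (simp add: quasinorm_def infnorm_mul)
next
  case (2 \<rho>)
  have "(\<Sum>j\<in>UNIV. \<bar>c * x $ j\<bar> powr \<rho>) = c powr \<rho> * (\<Sum>j\<in>UNIV. \<bar>x $ j\<bar> powr \<rho>)"
    using assms(2) by (simp add: abs_mult powr_mult sum_distrib_left)
  also have "\<dots> powr (1 / \<rho>) = c * (\<Sum>j\<in>UNIV. \<bar>x $ j\<bar> powr \<rho>) powr (1 / \<rho>)"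
    using assms(2) 2 by (subst powr_mult) (auto intro!: sum_nonneg simp: powr_powr)
  finally show ?thesis using 2 by (simp add: quasinorm_def)
qed

lemma tendsto_quasinorm:
  assumes r: "0 < r" and f: "(f \<longlongrightarrow> (a :: real ^ 'd)) F"
  shows "((\<lambda>x. quasinorm r (f x)) \<longlongrightarrow> quasinorm r a) F"
  using r
proof (cases rule: pos_ereal_cases)
  case 1 then show ?thesis using tendsto_infnorm[OF f] by (simp add: quasinorm_def)
next
  case (2 \<rho>)
  have "((\<lambda>x. (\<Sum>j\<in>UNIV. \<bar>f x $ j\<bar> powr \<rho>) powr (1 / \<rho>)) \<longlongrightarrow> (\<Sum>j\<in>UNIV. \<bar>a $ j\<bar> powr \<rho>) powr (1 / \<rho>)) F"
    using 2 by (intro tendsto_powr' tendsto_sum tendsto_rabs tendsto_vec_nth f tendsto_const)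
      (auto intro!: always_eventually sum_nonneg)
  then show ?thesis using 2 by (simp add: quasinorm_def)
qed

lemma continuous_on_quasinorm: "0 < r \<Longrightarrow> continuous_on S (quasinorm r)"
  unfolding continuous_on_def by (auto intro: tendsto_quasinorm)

text \<open>By homogeneity each ray from the origin meets the sphere at most once, and a closed set
  with this property is negligible.\<close>

lemma negligible_quasinorm_sphere:
  assumes "0 < r"
  shows "negligible {x :: real ^ 'd. quasinorm r x = 1}"
proof (rule starlike_negligible[where a = 0])
  show "closed {x :: real ^ 'd. quasinorm r x = 1}"
    by (intro closed_Collect_eq continuous_on_quasinorm assms continuous_on_const)
qed (use assms in \<open>auto simp: quasinorm_scaleR\<close>)

lemma sob_weight_1_eq:
  fixes k :: "int ^ 'd"
  shows "r = \<infinity> \<Longrightarrow> sob_weight 1 r k = max 1 (infnorm (\<chi> j. real_of_int (k $ j)))"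
    and "r = ereal \<rho> \<Longrightarrow> sob_weight 1 r k = (1 + (\<Sum>j\<in>UNIV. \<bar>real_of_int (k $ j)\<bar> powr \<rho>)) powr (1 / \<rho>)"
  by (simp_all add: sob_weight_def infnorm_eq_Max_cart max_def)

lemma sob_weight_ge_1:
  assumes "0 < r" shows "sob_weight 1 r k \<ge> 1"
  using assms
proof (cases rule: pos_ereal_cases)
  case (2 \<rho>)
  then show ?thesis by (auto simp: sob_weight_1_eq intro!: ge_one_powr_ge_zero sum_nonneg)
qed (simp add: sob_weight_1_eq)

text \<open>Reduces every smoothness to the weight with s = 1, which grows linearly in
  \<open>k\<close>; sorting by that weight sorts by all weights with s > 0.\<close>

lemma sob_weight_powr:
  assumes "0 < r" shows "sob_weight s r k = sob_weight 1 r k powr s"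
  using assms
proof (cases rule: pos_ereal_cases)
  case (2 \<rho>)
  then show ?thesis by (simp add: sob_weight_def powr_powr)
qed (simp add: sob_weight_def)

lemma sob_weight_pos: "0 < r \<Longrightarrow> sob_weight s r k > 0"
  using sob_weight_ge_1[of r k] by (simp add: sob_weight_powr[of r s])

lemma abs_le_sob_weight:
  fixes k :: "int ^ 'd"
  assumes "0 < r" shows "real_of_int \<bar>k $ i\<bar> \<le> sob_weight 1 r k"
  using assms
proof (cases rule: pos_ereal_cases)
  case 1
  have "\<bar>(\<chi> j. real_of_int (k $ j)) $ i\<bar> \<le> infnorm (\<chi> j. real_of_int (k $ j))"
    by (rule component_le_infnorm_cart)
  then show ?thesis by (simp add: sob_weight_1_eq 1)
next
  case (2 \<rho>)
  have "\<bar>real_of_int (k $ i)\<bar> = (\<bar>real_of_int (k $ i)\<bar> powr \<rho>) powr (1 / \<rho>)"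
    using 2 by (simp add: powr_powr)
  also have "\<dots> \<le> (1 + (\<Sum>j\<in>UNIV. \<bar>real_of_int (k $ j)\<bar> powr \<rho>)) powr (1 / \<rho>)"
  proof (rule powr_mono2)
    have "\<bar>real_of_int (k $ i)\<bar> powr \<rho> \<le> (\<Sum>j\<in>UNIV. \<bar>real_of_int (k $ j)\<bar> powr \<rho>)"
      by (rule member_le_sum) auto
    then show "\<bar>real_of_int (k $ i)\<bar> powr \<rho> \<le> 1 + (\<Sum>j\<in>UNIV. \<bar>real_of_int (k $ j)\<bar> powr \<rho>)" by simp
  qed (use 2 in auto)
  finally show ?thesis by (simp add: sob_weight_1_eq 2)
qed

text \<open>After division by \<open>t n\<close> the floor costs at most 1 / t n per coordinate, and
  the inhomogeneous 1 in the weight becomes (1 / t n)^\<rho> (or 1 / t n inside the maximum). Both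
  vanish, leaving the homogeneous quasinorm.\<close>

lemma tendsto_sob_weight_floor:
  fixes x :: "real ^ 'd" and t :: "nat \<Rightarrow> real"
  assumes r: "0 < r" and t: "filterlim t at_top sequentially" and t1: "\<And>n. t n \<ge> 1"
  shows "(\<lambda>n. sob_weight 1 r (\<chi> i. \<lfloor>t n * x $ i\<rfloor>) / t n) \<longlonglongrightarrow> quasinorm r x"
proof -
  have tpos: "t n > 0" for n using t1[of n] by simp
  have inv: "(\<lambda>n. 1 / t n) \<longlonglongrightarrow> 0"
    using tendsto_divide_0[OF tendsto_const filterlim_at_top_imp_at_infinity[OF t]] by simp
  define y where "y n = (\<chi> i. real_of_int \<lfloor>t n * x $ i\<rfloor> / t n)" for n
  have "(\<lambda>n. real_of_int \<lfloor>t n * x $ i\<rfloor> / t n) \<longlonglongrightarrow> x $ i" for i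
  proof (rule LIM_zero_cancel, rule Lim_null_comparison[OF _ inv])
    show "eventually (\<lambda>n. norm (real_of_int \<lfloor>t n * x $ i\<rfloor> / t n - x $ i) \<le> 1 / t n) sequentially"
    proof (intro always_eventually allI)
      fix n
      have "real_of_int \<lfloor>t n * x $ i\<rfloor> / t n - x $ i = (real_of_int \<lfloor>t n * x $ i\<rfloor> - t n * x $ i) / t n"
        using tpos[of n] by (simp add: field_simps)
      moreover have "\<bar>real_of_int \<lfloor>t n * x $ i\<rfloor> - t n * x $ i\<bar> \<le> 1" by linarith
      ultimately show "norm (real_of_int \<lfloor>t n * x $ i\<rfloor> / t n - x $ i) \<le> 1 / t n"
        using tpos[of n] by (simp add: divide_right_mono)
    qed
  qed
  then have y: "y \<longlonglongrightarrow> x" unfolding y_def by (intro vec_tendstoI) simp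
  show ?thesis
    using r
  proof (cases rule: pos_ereal_cases)
    case 1
    have "sob_weight 1 r (\<chi> i. \<lfloor>t n * x $ i\<rfloor>) / t n = max (1 / t n) (infnorm (y n))" for n
    proof -
      have "infnorm (y n) = infnorm ((1 / t n) *\<^sub>R (\<chi> i. real_of_int \<lfloor>t n * x $ i\<rfloor>))"
        by (rule arg_cong[of _ _ infnorm]) (simp add: y_def vec_eq_iff)
      also have "\<dots> = infnorm (\<chi> i. real_of_int \<lfloor>t n * x $ i\<rfloor>) / t n"
        using tpos[of n] by (simp only: infnorm_mul) simp
      finally show ?thesis using tpos[of n] by (simp add: sob_weight_1_eq 1 max_divide_distrib_right)
    qed
    moreover have "(\<lambda>n. max (1 / t n) (infnorm (y n))) \<longlonglongrightarrow> max 0 (infnorm x)"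
      by (intro tendsto_max inv tendsto_infnorm y)
    ultimately show ?thesis by (simp add: quasinorm_def 1 infnorm_pos_le max_absorb2)
  next
    case (2 \<rho>)
    have "sob_weight 1 r (\<chi> i. \<lfloor>t n * x $ i\<rfloor>) / t n
        = ((1 / t n) powr \<rho> + (\<Sum>j\<in>UNIV. \<bar>y n $ j\<bar> powr \<rho>)) powr (1 / \<rho>)" for n
    proof -
      let ?S = "1 + (\<Sum>j\<in>UNIV. \<bar>real_of_int \<lfloor>t n * x $ j\<rfloor>\<bar> powr \<rho>)"
      have "(1 / t n) powr \<rho> + (\<Sum>j\<in>UNIV. \<bar>y n $ j\<bar> powr \<rho>) = ?S / t n powr \<rho>"
        using tpos[of n] by (simp add: y_def powr_divide add_divide_distrib sum_divide_distrib)
      moreover have "(?S / t n powr \<rho>) powr (1 / \<rho>) = ?S powr (1 / \<rho>) / t n"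
        using tpos[of n] 2(2) by (subst powr_divide) (auto intro!: add_nonneg_nonneg sum_nonneg simp: powr_powr)
      ultimately show ?thesis by (simp add: sob_weight_1_eq(2)[OF refl] 2(1))
    qed
    moreover have "(\<lambda>n. ((1 / t n) powr \<rho> + (\<Sum>j\<in>UNIV. \<bar>y n $ j\<bar> powr \<rho>)) powr (1 / \<rho>))
      \<longlonglongrightarrow> (0 powr \<rho> + (\<Sum>j\<in>UNIV. \<bar>x $ j\<bar> powr \<rho>)) powr (1 / \<rho>)"
      using 2 tpos by (intro tendsto_powr' tendsto_sum tendsto_add tendsto_rabs tendsto_vec_nth y tendsto_const inv)
        (auto intro!: always_eventually sum_nonneg add_nonneg_nonneg simp: less_imp_le)
    ultimately show ?thesis using 2 by (simp add: quasinorm_def)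
  qed
qed

lemma finite_sob_weight_le:
  assumes "0 < r" shows "finite {k :: int ^ 'd. sob_weight 1 r k \<le> t}"
  by (rule finite_subset[OF _ finite_lattice_box[of t]])
    (auto intro!: order_trans[OF abs_le_sob_weight[OF assms, unfolded of_int_abs]])

text \<open>The dilation factor is chosen as the \<open>j\<close>-th weight itself. The first
  \<open>j\<close> frequencies then lie between the strict and the non-strict sublevel set, whatever
  the order among equal weights, and their number is exactly \<open>j\<close>.\<close>

lemma sorted_sob_weight_asymptotic:
  fixes e :: "nat \<Rightarrow> int ^ 'd"
  assumes r: "0 < r" and e: "bij e" and mono: "incseq (\<lambda>j. sob_weight 1 r (e j))"
  shows "(\<lambda>j. real j / sob_weight 1 r (e j) ^ CARD('d)) \<longlonglongrightarrow> measure lborel (unit_ball_r r :: (real ^ 'd) set)"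
proof -
  define t where "t j = sob_weight 1 r (e j)" for j
  have inj: "inj e" and surj: "surj e" using e by (auto simp: bij_def)
  have t1: "t j \<ge> 1" for j by (simp add: t_def sob_weight_ge_1[OF r])
  have t_top: "filterlim t at_top sequentially"
    unfolding filterlim_at_top
  proof
    fix Z
    have "\<not> range e \<subseteq> {k. sob_weight 1 r k \<le> Z}"
      using finite_sob_weight_le[OF r, of Z] finite_subset range_inj_infinite[OF inj] by blast
    then obtain j where "\<not> sob_weight 1 r (e j) \<le> Z" by auto
    then have "Z \<le> t j" by (simp add: t_def)
    then have "\<forall>i\<ge>j. Z \<le> t i" using incseqD[OF mono, of j] unfolding t_def by (meson order_trans)
    then show "eventually (\<lambda>j. Z \<le> t j) sequentially" by (auto simp: eventually_sequentially)
  qed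
  have lim: "(\<lambda>j. real (card (e ` {..<j})) / t j ^ CARD('d)) \<longlonglongrightarrow> measure lborel {x :: real ^ 'd. quasinorm r x \<le> 1}"
  proof (rule lattice_point_count)
    show "{k :: int ^ 'd. sob_weight 1 r k < t j} \<subseteq> e ` {..<j}" for j
    proof
      fix k :: "int ^ 'd" assume k: "k \<in> {k. sob_weight 1 r k < t j}"
      obtain i where i: "k = e i" using surj by blast
      have "\<not> j \<le> i" using k incseqD[OF mono, of j i] by (auto simp: i t_def)
      then show "k \<in> e ` {..<j}" using i by auto
    qed
    show "e ` {..<j} \<subseteq> {k. sob_weight 1 r k \<le> t j}" for j
      using incseqD[OF mono, of _ j] by (auto simp: t_def)
    show "real_of_int \<bar>k $ i\<bar> \<le> sob_weight 1 r k" for k :: "int ^ 'd" and i by (rule abs_le_sob_weight[OF r])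
  qed (intro t_top t1 tendsto_sob_weight_floor[OF r t_top t1] continuous_on_quasinorm[OF r] negligible_quasinorm_sphere[OF r])+
  moreover have "card (e ` {..<j}) = j" for j
    using card_image[OF inj_on_subset[OF inj subset_UNIV], of "{..<j}"] by simp
  ultimately show ?thesis by (simp add: t_def unit_ball_r_eq)
qed

lemma sorted_sob_weight_tail:
  fixes e :: "nat \<Rightarrow> int ^ 'd"
  assumes s: "s > real CARD('d) / 2" and r: "0 < r"
    and e: "bij e" and mono: "incseq (\<lambda>j. sob_weight 1 r (e j))"
  shows "summable (\<lambda>j. (1 / sob_weight s r (e j))\<^sup>2)"
    and "(\<lambda>n. real (Suc n) powr (s / real CARD('d) - 1 / 2) * sqrt (\<Sum>j. (1 / sob_weight s r (e (j + n)))\<^sup>2))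
      \<longlonglongrightarrow> sqrt (real CARD('d) / (2 * s - real CARD('d))) *
        measure lborel (unit_ball_r r :: (real ^ 'd) set) powr (s / real CARD('d))"
proof -
  define d where "d = real CARD('d)"
  have d: "d > 0" by (simp add: d_def)
  \<comment> \<open>Chosen so that the squared weight of order \<open>s\<close> is the
    \<open>p\<close>-th power of \<open>sob_weight 1 r (e j) ^ CARD('d)\<close>.\<close>
  define p where "p = 2 * s / d"
  have p: "p > 1" using s d by (simp add: p_def d_def field_simps)
  define V where "V = measure lborel (unit_ball_r r :: (real ^ 'd) set)"
  have V: "V \<ge> 0" by (simp add: V_def)
  define a where "a j = (1 / sob_weight s r (e j))\<^sup>2" for j
  have "(\<lambda>j. (real j / sob_weight 1 r (e j) ^ CARD('d)) powr p) \<longlonglongrightarrow> V powr p"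
  proof (rule tendsto_powr'[OF _ tendsto_const])
    show "(\<lambda>j. real j / sob_weight 1 r (e j) ^ CARD('d)) \<longlonglongrightarrow> V"
      unfolding V_def by (rule sorted_sob_weight_asymptotic[OF r e mono])
    have "real j / sob_weight 1 r (e j) ^ CARD('d) \<ge> 0" for j
      using sob_weight_pos[OF r, of 1 "e j"] by simp
    then show "V \<noteq> 0 \<or> p > 0 \<and> (\<forall>\<^sub>F j in sequentially. 0 \<le> real j / sob_weight 1 r (e j) ^ CARD('d))"
      using p by simp
  qed
  moreover have "(real j / sob_weight 1 r (e j) ^ CARD('d)) powr p = a j * real j powr p" for j
  proof -
    have w: "sob_weight 1 r (e j) > 0" by (rule sob_weight_pos[OF r])
    have "(sob_weight 1 r (e j) ^ CARD('d)) powr p = sob_weight 1 r (e j) powr (2 * s)"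
      using w d by (simp add: powr_realpow[symmetric] powr_powr p_def d_def[symmetric])
    also have "\<dots> = (sob_weight s r (e j))\<^sup>2"
      using w by (simp add: sob_weight_powr[OF r, of s] powr_powr powr_realpow[symmetric] mult.commute)
    finally show ?thesis using w by (simp add: powr_divide a_def power_divide)
  qed
  ultimately have l: "(\<lambda>j. a j * real j powr p) \<longlonglongrightarrow> V powr p" by simp
  show "summable (\<lambda>j. (1 / sob_weight s r (e j))\<^sup>2)"
    using power_tail_sum_asymptotic(1)[OF p l] by (simp add: a_def)
  \<comment> \<open>The tail starting at \<open>n\<close> belongs to the approximation number of
    index n + 1, so the factor \<open>n\<close> is replaced by \<open>Suc n\<close>.\<close>
  have "(\<lambda>n. ((real n + 1) / real n) powr (p - 1)) \<longlonglongrightarrow> 1" using p by real_asymp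
  from tendsto_mult[OF this power_tail_sum_asymptotic(2)[OF p l]]
  have "(\<lambda>n. ((real n + 1) / real n) powr (p - 1) * (real n powr (p - 1) * (\<Sum>j. a (j + n)))) \<longlonglongrightarrow> V powr p / (p - 1)"
    by simp
  moreover have "eventually (\<lambda>n. ((real n + 1) / real n) powr (p - 1) * (real n powr (p - 1) * (\<Sum>j. a (j + n)))
      = real (Suc n) powr (p - 1) * (\<Sum>j. a (j + n))) sequentially"
    using eventually_gt_at_top[of 0] by eventually_elim (simp add: powr_divide add.commute)
  ultimately have "(\<lambda>n. real (Suc n) powr (p - 1) * (\<Sum>j. a (j + n))) \<longlonglongrightarrow> V powr p / (p - 1)"
    by (rule Lim_transform_eventually)
  from tendsto_real_sqrt[OF this]
  have "(\<lambda>n. sqrt (real (Suc n) powr (p - 1)) * sqrt (\<Sum>j. a (j + n))) \<longlonglongrightarrow> sqrt (V powr p / (p - 1))"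
    by (simp add: real_sqrt_mult)
  moreover have "sqrt (x powr q) = x powr (q / 2)" if "x \<ge> 0" for x q :: real
    using that by (simp add: powr_half_sqrt[symmetric] powr_powr)
  moreover have "(p - 1) / 2 = s / d - 1 / 2" "p / 2 = s / d" "1 / (p - 1) = d / (2 * s - d)"
    using d p by (auto simp: p_def field_simps)
  moreover have "sqrt (V powr p / (p - 1)) = sqrt (1 / (p - 1)) * sqrt (V powr p)"
    by (simp add: real_sqrt_mult[symmetric])
  ultimately show "(\<lambda>n. real (Suc n) powr (s / real CARD('d) - 1 / 2) * sqrt (\<Sum>j. (1 / sob_weight s r (e (j + n)))\<^sup>2))
      \<longlonglongrightarrow> sqrt (real CARD('d) / (2 * s - real CARD('d))) *
        measure lborel (unit_ball_r r :: (real ^ 'd) set) powr (s / real CARD('d))"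
    using V by (simp add: a_def V_def d_def)
qed

section \<open>Characters and uniqueness of Fourier coefficients\<close>

definition character :: "int ^ 'd \<Rightarrow> real ^ 'd \<Rightarrow> complex" where
  "character k x = cis (\<Sum>j\<in>UNIV. real_of_int (k $ j) * x $ j)"

lemma norm_character [simp]: "cmod (character k x) = 1"
  by (simp add: character_def)

lemma character_0 [simp]: "character 0 x = 1"
  by (simp add: character_def)

lemma character_add: "character (k + l) x = character k x * character l x"
  by (simp add: character_def cis_mult algebra_simps sum.distrib)

lemma cnj_character: "cnj (character k x) = character (- k) x"
  by (simp add: character_def cis_cnj sum_negf)

lemma continuous_on_character [continuous_intros]: "continuous_on S (character k)"
  unfolding character_def[abs_def]
  by (simp only: cis_conv_exp) (intro continuous_intros)

lemma borel_measurable_lebesgue_on: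
  assumes "g \<in> borel_measurable borel"
  shows "g \<in> borel_measurable (lebesgue_on S)"
  using assms by (intro measurable_restrict_space1 measurable_completion) simp

lemma measurable_character [measurable]: "character k \<in> borel_measurable (lebesgue_on S)"
  by (intro borel_measurable_lebesgue_on borel_measurable_continuous_onI continuous_intros)

lemma fourier_coeff_character:
  "fourier_coeff f k = complex_of_real (1 / (2 * pi) ^ CARD('d)) *
     (LINT x | lebesgue_on (torus :: (real ^ 'd) set). f x * character (- k) x)"
  unfolding fourier_coeff_def character_def
  by (simp add: cis_conv_exp sum_negf mult.commute)

lemma torus_borel [measurable]: "(torus :: (real ^ 'd) set) \<in> sets borel"
  unfolding torus_def by measurable

lemma torus_lebesgue [simp]: "(torus :: (real ^ 'd) set) \<in> sets lebesgue"
  using torus_borel sets_completionI_sets by fastforce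

lemma bounded_torus: "bounded (torus :: (real ^ 'd) set)"
  by (rule bounded_subset[OF bounded_cbox[of 0 "\<chi> i. 2 * pi"]])
    (auto simp: torus_def mem_box_cart, meson less_imp_le)

lemma finite_measure_torus: "finite_measure (lebesgue_on (torus :: (real ^ 'd) set))"
proof (rule finite_measure_lebesgue_on)
  show "(torus :: (real ^ 'd) set) \<in> lmeasurable"
    by (intro bounded_set_imp_lmeasurable bounded_torus torus_lebesgue)
qed

lemma integrable_bounded_torus:
  fixes g :: "real ^ 'd \<Rightarrow> complex"
  assumes "g \<in> borel_measurable (lebesgue_on torus)" "AE x in lebesgue_on torus. cmod (g x) \<le> B"
  shows "integrable (lebesgue_on torus) g"
  using finite_measure.integrable_const_bound[OF finite_measure_torus assms(2,1)] .

lemma integrable_character [simp]: "integrable (lebesgue_on torus) (character k)"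
  by (rule integrable_bounded_torus[where B = 1]) auto

text \<open>Fubini for product functions. \<open>lborel\<close> is the image of a product measure
  indexed by \<open>Basis\<close>, so the coordinate functions are re-indexed by basis vectors;
  \<open>g\<close> does this by inverting the map from \<open>i\<close> to
  \<open>axis i 1\<close>.\<close>

lemma lborel_integral_prod_cart:
  fixes f :: "'d::finite \<Rightarrow> real \<Rightarrow> complex"
  assumes f: "\<And>i. integrable lborel (f i)"
  shows "(LINT x | (lborel :: (real ^ 'd) measure). (\<Prod>i\<in>UNIV. f i (x $ i))) = (\<Prod>i\<in>UNIV. (LINT t | lborel. f i t))"
proof -
  interpret product_sigma_finite "\<lambda>_. lborel :: real measure" ..
  define g :: "real ^ 'd \<Rightarrow> real \<Rightarrow> complex" where "g b = f (THE i. b = axis i 1)" for b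
  have g: "g (axis i 1) = f i" for i by (simp add: g_def axis_eq_axis)
  have B: "(Basis :: (real ^ 'd) set) = range (\<lambda>i. axis i 1)" by (auto simp: Basis_vec_def)
  have inj: "inj (\<lambda>i :: 'd. axis i (1 :: real))" by (auto simp: inj_on_def axis_eq_axis)
  have pr: "(\<Prod>b\<in>(Basis :: (real ^ 'd) set). h b) = (\<Prod>i\<in>UNIV. h (axis i 1))" for h :: "_ \<Rightarrow> complex"
    unfolding B by (simp add: prod.reindex[OF inj])
  have gi: "integrable lborel (g b)" if "b \<in> Basis" for b using that f by (auto simp: B g)
  have [measurable]: "f i \<in> borel_measurable borel" for i using borel_measurable_integrable[OF f] by simp
  have "(LINT x | (lborel :: (real ^ 'd) measure). (\<Prod>i\<in>UNIV. f i (x $ i)))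
      = (LINT y | (\<Pi>\<^sub>M b\<in>Basis. lborel). (\<Prod>i\<in>UNIV. f i ((\<Sum>b\<in>Basis. y b *\<^sub>R b :: real ^ 'd) $ i)))"
    by (subst lborel_eq, subst integral_distr) (auto simp: cart_eq_inner_axis)
  also have "\<dots> = (LINT y | (\<Pi>\<^sub>M b\<in>Basis. lborel). (\<Prod>b\<in>(Basis :: (real ^ 'd) set). g b (y b)))"
  proof (rule Bochner_Integration.integral_cong[OF refl])
    fix y :: "real ^ 'd \<Rightarrow> real"
    have "(\<Sum>b\<in>Basis. y b *\<^sub>R b :: real ^ 'd) $ i = y (axis i 1)" for i
      by (simp add: cart_eq_inner_axis inner_sum_left_Basis axis_in_Basis_iff)
    then show "(\<Prod>i\<in>UNIV. f i ((\<Sum>b\<in>Basis. y b *\<^sub>R b :: real ^ 'd) $ i)) = (\<Prod>b\<in>(Basis :: (real ^ 'd) set). g b (y b))"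
      by (simp add: pr g)
  qed
  also have "\<dots> = (\<Prod>b\<in>(Basis :: (real ^ 'd) set). (LINT t | lborel. g b t))"
    by (rule product_integral_prod) (auto intro: gi)
  also have "\<dots> = (\<Prod>i\<in>UNIV. (LINT t | lborel. f i t))" by (simp add: pr g)
  finally show ?thesis .
qed

lemma integral_cis_period:
  fixes m :: int
  defines "h \<equiv> \<lambda>t::real. indicator {0..<2 * pi} t *\<^sub>R cis (of_int m * t)"
  shows "integrable lborel h" and "(LINT t | lborel. h t) = (if m = 0 then 2 * pi else 0)"
proof -
  \<comment> \<open>The closed interval makes compactness and the fundamental theorem applicable;
    \<open>h'\<close> differs from \<open>h\<close> only at the point 2 pi.\<close>
  define h' where "h' = (\<lambda>t::real. indicator {0..2 * pi} t *\<^sub>R cis (of_int m * t))"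
  have hm: "h \<in> borel_measurable lborel" "h' \<in> borel_measurable lborel"
    unfolding h_def h'_def by (simp_all add: cis_conv_exp)
  have ae: "AE t in lborel. h t = h' t"
    using AE_lborel_singleton[of "2 * pi"] by eventually_elim (auto simp: h_def h'_def indicator_def)
  have "integrable lborel h'"
    unfolding h'_def by (rule borel_integrable_compact) (auto intro!: continuous_intros simp: cis_conv_exp)
  with ae hm show "integrable lborel h" by (subst integrable_cong_AE)
  have "(LINT t | lborel. h t) = (LINT t | lborel. h' t)" by (rule integral_cong_AE[OF hm ae])
  also have "\<dots> = (if m = 0 then 2 * pi else 0)"
  proof (cases "m = 0")
    case True then show ?thesis by (simp add: h'_def scaleR_conv_of_real)
  next
    case False
    define F where "F t = cis (of_int m * t) / (\<i> * of_int m)" for t :: real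
    have "(LINT t | lborel. h' t) = F (2 * pi) - F 0"
      unfolding h'_def
    proof (rule integral_FTC_Icc)
      show "(F has_vector_derivative cis (of_int m * t)) (at t within {0..2 * pi})" for t
      proof -
        have "((\<lambda>z. exp (\<i> * (of_int m * z)) / (\<i> * of_int m)) has_field_derivative exp (\<i> * (of_int m * of_real t)))
            (at (of_real t))"
          using False by (auto intro!: derivative_eq_intros simp: algebra_simps)
        from has_vector_derivative_real_field[OF this] show ?thesis
          by (simp add: F_def[abs_def] cis_conv_exp)
      qed
    qed (auto intro!: continuous_intros simp: cis_conv_exp)
    also have "F (2 * pi) = F 0"
      using cis_multiple_2pi[of "of_int m"] by (simp add: F_def mult.commute mult.assoc)
    finally show ?thesis using False by simp
  qed
  finally show "(LINT t | lborel. h t) = (if m = 0 then 2 * pi else 0)" .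
qed

lemma integral_character:
  "(LINT x | lebesgue_on (torus :: (real ^ 'd) set). character k x) = (if k = 0 then (2 * pi) ^ CARD('d) else 0)"
proof -
  have "(LINT x | lebesgue_on torus. character k x) = (LINT x | lebesgue. indicator torus x *\<^sub>R character k x)"
    by (rule integral_restrict_space) simp
  also have "\<dots> = (LINT x | lborel. indicator torus x *\<^sub>R character k x)"
  proof (rule integral_completion)
    have [measurable]: "character k \<in> borel_measurable borel"
      by (intro borel_measurable_continuous_onI continuous_intros)
    show "(\<lambda>x. indicator torus x *\<^sub>R character k x) \<in> borel_measurable lborel"
      by measurable
  qed
  also have "\<dots> = (LINT x | lborel. (\<Prod>i\<in>UNIV. indicator {0..<2 * pi} (x $ i) *\<^sub>R cis (of_int (k $ i) * x $ i)))"
  proof (rule Bochner_Integration.integral_cong[OF refl])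
    fix x :: "real ^ 'd"
    have "cis (\<Sum>j\<in>S. f j) = (\<Prod>j\<in>S. cis (f j))" if "finite S" for f and S :: "'d set"
      using that by induction (simp_all add: cis_mult[symmetric])
    then show "indicator torus x *\<^sub>R character k x = (\<Prod>i\<in>UNIV. indicator {0..<2 * pi} (x $ i) *\<^sub>R cis (of_int (k $ i) * x $ i))"
      by (auto simp: character_def torus_def indicator_def)
  qed
  also have "\<dots> = (\<Prod>i\<in>UNIV. if k $ i = 0 then 2 * pi else 0)"
    by (subst lborel_integral_prod_cart) (simp_all add: integral_cis_period)
  also have "\<dots> = (if k = 0 then (2 * pi) ^ CARD('d) else 0)"
    by (auto simp: vec_eq_iff)
  finally show ?thesis .
qed

lemma fourier_coeff_of_character:
  "fourier_coeff (character l) k = (if k = l then 1 else (0 :: complex))"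
proof -
  have "(LINT x | lebesgue_on torus. character l x * character (- k) x)
      = (LINT x | lebesgue_on torus. character (l - k) x)"
    by (simp add: character_add[symmetric])
  then show ?thesis by (auto simp: fourier_coeff_character integral_character)
qed

text \<open>Generated by closure rules instead of explicit finite sums, so that products, continuity
  and vanishing integrals all follow by induction.\<close>

inductive trig_poly :: "(real ^ 'd \<Rightarrow> complex) \<Rightarrow> bool" where
  trig_poly_character: "trig_poly (character k)"
| trig_poly_add: "trig_poly p \<Longrightarrow> trig_poly q \<Longrightarrow> trig_poly (\<lambda>x. p x + q x)"
| trig_poly_cmult: "trig_poly p \<Longrightarrow> trig_poly (\<lambda>x. c * p x)"

lemma trig_poly_mult:
  assumes "trig_poly p" "trig_poly q"
  shows "trig_poly (\<lambda>x. p x * q x)"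
  using assms(1)
proof induction
  case (trig_poly_character k)
  show ?case
    using assms(2)
  proof induction
    case (trig_poly_character l)
    have "(\<lambda>x. character k x * character l x) = character (k + l)" by (auto simp: character_add)
    then show ?case by (simp add: trig_poly.trig_poly_character)
  next
    case (trig_poly_add p q)
    then show ?case using trig_poly.trig_poly_add by (fastforce simp: distrib_left)
  next
    case (trig_poly_cmult p c)
    from trig_poly.trig_poly_cmult[OF this(2), of c] show ?case by (simp add: mult.left_commute)
  qed
next
  case (trig_poly_add p q)
  then show ?case using trig_poly.trig_poly_add by (fastforce simp: distrib_right)
next
  case (trig_poly_cmult p c)
  from trig_poly.trig_poly_cmult[OF this(2), of c] show ?case by (simp add: mult.assoc)
qed

lemma trig_poly_const: "trig_poly (\<lambda>_. c)"
  using trig_poly_cmult[OF trig_poly_character[of 0], of c] by simp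

lemma continuous_on_trig_poly: "trig_poly p \<Longrightarrow> continuous_on S p"
  by (induction rule: trig_poly.induct) (auto intro!: continuous_intros)

lemma integrable_mult_bounded:
  fixes f g :: "'a \<Rightarrow> complex"
  assumes f: "integrable M f" and g: "g \<in> borel_measurable M" and B: "\<And>x. cmod (g x) \<le> B"
  shows "integrable M (\<lambda>x. f x * g x)"
proof (rule Bochner_Integration.integrable_bound)
  show "integrable M (\<lambda>x. B * cmod (f x))" using f by simp
  have "cmod (f x * g x) \<le> B * cmod (f x)" for x
    using mult_right_mono[OF B[of x], of "cmod (f x)"] by (simp add: norm_mult mult.commute)
  then show "AE x in M. norm (f x * g x) \<le> norm (B * cmod (f x))"
    by (intro AE_I2) (simp, meson abs_ge_self order_trans)
qed (use f g in measurable)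

lemma integrable_mult_character:
  "integrable (lebesgue_on torus) f \<Longrightarrow> integrable (lebesgue_on torus) (\<lambda>x. f x * character k x)"
  by (rule integrable_mult_bounded[where B = 1]) auto

lemma integral_trig_poly_eq_0:
  fixes f :: "real ^ 'd \<Rightarrow> complex"
  assumes f: "integrable (lebesgue_on torus) f" and z: "\<And>k. fourier_coeff f k = 0"
    and p: "trig_poly p"
  shows "integrable (lebesgue_on torus) (\<lambda>x. f x * p x) \<and> (LINT x | lebesgue_on torus. f x * p x) = 0"
  using p
proof induction
  case (trig_poly_character k)
  show ?case using z[of "- k"] integrable_mult_character[OF f] by (simp add: fourier_coeff_character)
next
  case (trig_poly_add p q)
  then show ?case by (simp add: distrib_left)
next
  case (trig_poly_cmult p c)
  then show ?case by (simp add: mult.left_commute[of _ c])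
qed

text \<open>Passing to \<open>cis (x $ i)\<close> turns periodic functions into functions on a compact product of circles,
  where Stone--Weierstrass applies.\<close>

lemma trig_poly_approx:
  fixes g :: "complex ^ 'd \<Rightarrow> real"
  assumes g: "continuous_on {z. \<forall>i. cmod (z $ i) = 1} g" and e: "\<epsilon> > 0"
  obtains p where "trig_poly p" "\<And>x. cmod (complex_of_real (g (\<chi> i. cis (x $ i))) - p x) < \<epsilon>"
proof -
  define S where "S = {z :: complex ^ 'd. \<forall>i. cmod (z $ i) = 1}"
  define E where "E x = (\<chi> i. cis (x $ i))" for x :: "real ^ 'd"
  \<comment> \<open>The algebra for Stone-Weierstrass: real continuous functions on the product of
    circles whose pullback along \<open>E\<close> is a trigonometric polynomial. Taking real
    functions suits the real form of that theorem.\<close>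
  define R where "R = {h :: complex ^ 'd \<Rightarrow> real. continuous_on S h \<and> trig_poly (\<lambda>x. complex_of_real (h (E x)))}"
  have ES: "E x \<in> S" for x by (simp add: E_def S_def)
  interpret function_ring_on R S
  proof
    have "closed S" unfolding S_def
      by (intro closed_Collect_all closed_Collect_eq continuous_intros)
    moreover have "bounded S"
      unfolding bounded_iff
    proof (intro exI ballI)
      fix z assume "z \<in> S"
      have "norm z \<le> (\<Sum>i\<in>UNIV. norm (z $ i))" by (simp add: norm_vec_def L2_set_le_sum)
      also have "\<dots> \<le> real CARD('d)" using \<open>z \<in> S\<close> by (simp add: S_def)
      finally show "norm z \<le> real CARD('d)" .
    qed
    ultimately show "compact S" by (simp add: compact_eq_bounded_closed)
  next
    fix x y assume xy: "x \<in> S" "y \<in> S" "x \<noteq> y"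
    then obtain i where i: "x $ i \<noteq> y $ i" by (auto simp: vec_eq_iff)
    have ch: "character (axis i 1) x = cis (x $ i)" "character (axis i (-1)) x = cis (- (x $ i))" for x :: "real ^ 'd"
      by (auto simp: character_def axis_def if_distrib if_distribR sum.delta cong: if_cong)
    have 1: "trig_poly (\<lambda>x :: real ^ 'd. a * cis (x $ i) + b * cis (- (x $ i)))" for a b
      using trig_poly_add[OF trig_poly_cmult[OF trig_poly_character[of "axis i 1"], of a]
          trig_poly_cmult[OF trig_poly_character[of "axis i (-1)"], of b]] by (simp add: ch)
    \<comment> \<open>Cosine and sine of one coordinate are combinations of the two characters of
      frequency 1 and -1 in direction \<open>i\<close>. Distinct points differ in the real or
      imaginary part of some coordinate, so these functions separate points.\<close>
    have "(\<lambda>x. complex_of_real (Re (E x $ i))) = (\<lambda>x. (1 / 2) * cis (x $ i) + (1 / 2) * cis (- (x $ i)))"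
      by (auto simp: E_def complex_eq_iff)
    with 1[of "1 / 2" "1 / 2"] have "(\<lambda>z. Re (z $ i)) \<in> R" by (auto simp: R_def intro!: continuous_intros)
    moreover have "(\<lambda>x. complex_of_real (Im (E x $ i))) = (\<lambda>x. (- \<i> / 2) * cis (x $ i) + (\<i> / 2) * cis (- (x $ i)))"
      by (auto simp: E_def complex_eq_iff)
    with 1[of "- \<i> / 2" "\<i> / 2"] have "(\<lambda>z. Im (z $ i)) \<in> R" by (auto simp: R_def intro!: continuous_intros)
    ultimately show "\<exists>f\<in>R. f x \<noteq> f y" using i
      by (auto simp: complex_eq_iff intro: bexI[of _ "\<lambda>z. Re (z $ i)"] bexI[of _ "\<lambda>z. Im (z $ i)"])
  qed (auto simp: R_def trig_poly_const intro!: continuous_intros trig_poly_add trig_poly_mult)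
  obtain h where h: "h \<in> R" "\<forall>z\<in>S. \<bar>g z - h z\<bar> < \<epsilon>"
    using Stone_Weierstrass_basic[of g \<epsilon>] g e by (auto simp: S_def)
  show ?thesis
  proof (rule that)
    show "trig_poly (\<lambda>x. complex_of_real (h (E x)))" using h by (simp add: R_def)
    show "cmod (complex_of_real (g (\<chi> i. cis (x $ i))) - complex_of_real (h (E x))) < \<epsilon>" for x
      using h(2) ES[of x] by (auto simp: E_def simp flip: of_real_diff)
  qed
qed

text \<open>Inner regularity: the set where \<open>h\<close> is positive contains a compact
  \<open>K\<close> missing arbitrarily little of it. The integral of \<open>h\<close> over
  \<open>K\<close> vanishes although \<open>h\<close> is positive there, so \<open>K\<close> is
  null, and hence so is the whole set.\<close>

lemma AE_zero_of_compact_integrals: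
  fixes h :: "'a::euclidean_space \<Rightarrow> real"
  assumes S: "S \<in> sets lebesgue" "bounded S" and h: "integrable (lebesgue_on S) h"
    and z: "\<And>K. compact K \<Longrightarrow> K \<subseteq> S \<Longrightarrow> (LINT x | lebesgue_on S. h x * indicator K x) = 0"
  shows "AE x in lebesgue_on S. h x \<le> 0"
proof -
  define P where "P = {x \<in> S. h x > 0}"
  have hm: "h \<in> borel_measurable (lebesgue_on S)" using h by auto
  have "{x \<in> space (lebesgue_on S). h x > 0} \<in> sets (lebesgue_on S)" using hm by measurable
  then have "P \<in> sets (lebesgue_on S)" by (simp add: P_def)
  then have P: "P \<in> sets lebesgue" using S by (auto simp: sets_restrict_space_iff)
  have "emeasure lebesgue P \<le> ennreal \<epsilon>" if "\<epsilon> > 0" for \<epsilon>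
  proof -
    obtain K where K: "closed K" "K \<subseteq> P" "P - K \<in> lmeasurable" "emeasure lebesgue (P - K) < ennreal \<epsilon>"
      using sets_lebesgue_inner_closed[OF P \<open>\<epsilon> > 0\<close>] by blast
    have KS: "K \<subseteq> S" using K by (auto simp: P_def)
    have "compact K" using K KS S bounded_subset by (auto simp: compact_eq_bounded_closed)
    have Ks: "K \<in> sets lebesgue" using K(1) by auto
    then have Ks': "K \<in> sets (lebesgue_on S)" using S KS by (auto simp: sets_restrict_space_iff)
    have "AE x in lebesgue_on S. h x * indicator K x = 0"
    proof (subst integral_nonneg_eq_0_iff_AE[symmetric])
      show "integrable (lebesgue_on S) (\<lambda>x. h x * indicator K x)"
        using h Ks' by (rule integrable_real_mult_indicator[rotated])
      show "AE x in lebesgue_on S. 0 \<le> h x * indicator K x"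
        using K by (intro AE_I2) (auto simp: P_def indicator_def)
    qed (use z \<open>compact K\<close> KS in auto)
    then have "AE x in lebesgue_on S. x \<notin> K"
      by eventually_elim (use K in \<open>auto simp: P_def indicator_def\<close>)
    then have "AE x in lebesgue. x \<in> S \<longrightarrow> x \<notin> K" using S by (subst (asm) AE_restrict_space_iff) auto
    then have "AE x in lebesgue. x \<notin> K" by eventually_elim (use KS in auto)
    then have K0: "emeasure lebesgue K = 0" using Ks by (subst (asm) AE_iff_measurable[OF Ks]) auto
    have "emeasure lebesgue P \<le> emeasure lebesgue K + emeasure lebesgue (P - K)"
      using K(2) Ks P emeasure_subadditive[of K lebesgue "P - K"] by (auto simp: Un_absorb1)
    then show ?thesis using K K0 by (simp add: less_imp_le order_trans)
  qed
  then have "emeasure lebesgue P = 0"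
    by (metis ennreal_le_epsilon add.left_neutral le_zero_eq)
  then have "AE x in lebesgue. x \<notin> P" using P by (intro AE_not_in) (auto simp: null_sets_def)
  then show ?thesis using S by (subst AE_restrict_space_iff) (auto simp: P_def elim!: eventually_mono)
qed

text \<open>Orthogonality to \<open>f\<close> is carried from trigonometric polynomials to
  continuous functions of \<open>E x\<close> by uniform approximation, and from those to indicators
  of compact sets by dominated convergence.\<close>

lemma fourier_uniqueness:
  fixes f :: "real ^ 'd \<Rightarrow> complex"
  assumes f: "integrable (lebesgue_on torus) f" and z: "\<And>k. fourier_coeff f k = 0"
  shows "AE x in lebesgue_on torus. f x = 0"
proof -
  define E where "E x = (\<chi> i. cis (x $ i))" for x :: "real ^ 'd"
  have contE: "continuous_on A E" for A unfolding E_def cis_conv_exp by (intro continuous_intros)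
  \<comment> \<open>The half-open fundamental domain makes \<open>E\<close> injective, so for
    \<open>x\<close> in the torus \<open>E x\<close> lies in the image of \<open>K\<close> only if
    \<open>x\<close> lies in \<open>K\<close>.\<close>
  have injE: "x = y" if "x \<in> torus" "y \<in> torus" "E x = E y" for x y
  proof -
    have "x $ i = y $ i" for i
    proof -
      have "cis (x $ i) = cis (y $ i)" using that(3) by (auto simp: E_def vec_eq_iff)
      then obtain n :: int where n: "x $ i = y $ i + 2 * pi * n"
        using sin_cos_eq_iff[of "x $ i" "y $ i"] by (auto simp: complex_eq_iff)
      have "\<bar>x $ i - y $ i\<bar> < 2 * pi" using that(1,2) by (auto simp: torus_def abs_less_iff) (smt (verit))+
      then have "2 * pi * \<bar>real_of_int n\<bar> < 2 * pi * 1" by (simp add: n abs_mult)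
      then have "\<bar>real_of_int n\<bar> < 1" by (subst (asm) mult_less_cancel_left_pos) auto
      then show ?thesis using n by simp
    qed
    then show ?thesis by (simp add: vec_eq_iff)
  qed
  have cont0: "(LINT x | lebesgue_on torus. f x * complex_of_real (g (E x))) = 0"
    if g: "continuous_on UNIV g" for g
  proof -
    define I where "I = (LINT x | lebesgue_on torus. cmod (f x))"
    have "cmod (LINT x | lebesgue_on torus. f x * complex_of_real (g (E x))) \<le> \<epsilon> * I" if e: "\<epsilon> > 0" for \<epsilon>
    proof -
      obtain p where p: "trig_poly p" "\<And>x. cmod (complex_of_real (g (E x)) - p x) < \<epsilon>"
        using trig_poly_approx[OF continuous_on_subset[OF g] e] by (auto simp: E_def)
      let ?q = "\<lambda>x. complex_of_real (g (E x)) - p x"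
      have gEc: "continuous_on UNIV (\<lambda>x. complex_of_real (g (E x)))"
        using g contE by (intro continuous_intros continuous_on_compose2[OF g]) auto
      have qm: "?q \<in> borel_measurable (lebesgue_on torus)"
        by (intro borel_measurable_diff borel_measurable_lebesgue_on borel_measurable_continuous_onI gEc
            continuous_on_trig_poly p)
      have qi: "integrable (lebesgue_on torus) (\<lambda>x. f x * ?q x)"
        using p by (intro integrable_mult_bounded[OF f qm, of \<epsilon>] less_imp_le)
      have "(LINT x | lebesgue_on torus. f x * complex_of_real (g (E x)))
          = (LINT x | lebesgue_on torus. f x * ?q x + f x * p x)" by (simp add: algebra_simps)
      also have "\<dots> = (LINT x | lebesgue_on torus. f x * ?q x)"
        using qi integral_trig_poly_eq_0[OF f z p(1)] by (subst Bochner_Integration.integral_add) auto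
      finally have "cmod (LINT x | lebesgue_on torus. f x * complex_of_real (g (E x)))
          \<le> (LINT x | lebesgue_on torus. cmod (f x * ?q x))" by simp
      also have "\<dots> \<le> (LINT x | lebesgue_on torus. \<epsilon> * cmod (f x))"
      proof (rule integral_mono)
        show "cmod (f x * ?q x) \<le> \<epsilon> * cmod (f x)" for x
          using mult_left_mono[OF less_imp_le[OF p(2)[of x]], of "cmod (f x)"] by (simp add: norm_mult mult.commute)
      qed (use qi f in auto)
      finally show ?thesis by (simp add: I_def)
    qed
    note le = this
    have "((\<lambda>\<epsilon>. \<epsilon> * I) \<longlongrightarrow> 0 * I) (at_right 0)" by (intro tendsto_intros)
    then have "cmod (LINT x | lebesgue_on torus. f x * complex_of_real (g (E x))) \<le> 0 * I"
      using le by (intro tendsto_lowerbound[of _ _ "at_right 0"])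
        (auto simp: eventually_at_right_less intro: eventually_mono[OF eventually_at_right_less])
    then show ?thesis by simp
  qed
  have comp: "(LINT x | lebesgue_on torus. f x * indicator K x) = 0" if K: "compact K" "K \<subseteq> torus" for K
  proof (cases "K = {}")
    case True then show ?thesis by simp
  next
    case False
    define C where "C = E ` K"
    have C: "closed C" "C \<noteq> {}"
      using False K contE by (auto simp: C_def intro!: compact_imp_closed compact_continuous_image)
    \<comment> \<open>Urysohn functions: 1 on \<open>C\<close>, and tending to 0 at every point of
      positive distance from the closed set \<open>C\<close>.\<close>
    define g where "g n z = max 0 (1 - real n * infdist z C)" for n z
    have gE: "g n (E x) \<in> {0..1}" for n x by (auto simp: g_def infdist_nonneg)
    have gc: "continuous_on UNIV (g n)" for n
      unfolding g_def by (intro continuous_intros)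
    have "(\<lambda>n. LINT x | lebesgue_on torus. f x * complex_of_real (g n (E x)))
        \<longlonglongrightarrow> (LINT x | lebesgue_on torus. f x * indicator K x)"
    proof (rule integral_dominated_convergence)
      show "integrable (lebesgue_on torus) (\<lambda>x. cmod (f x))" using f by simp
      have "continuous_on UNIV (\<lambda>x. complex_of_real (g n (E x)))" for n
        using contE by (intro continuous_intros continuous_on_compose2[OF gc]) auto
      then have "(\<lambda>x. complex_of_real (g n (E x))) \<in> borel_measurable (lebesgue_on torus)" for n
        by (intro borel_measurable_lebesgue_on borel_measurable_continuous_onI)
      then show "(\<lambda>x. f x * complex_of_real (g n (E x))) \<in> borel_measurable (lebesgue_on torus)" for n
        using f by (intro borel_measurable_times) auto
      have "(indicator K :: _ \<Rightarrow> complex) \<in> borel_measurable (lebesgue_on torus)"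
        by (intro borel_measurable_lebesgue_on borel_measurable_indicator borel_compact[OF K(1)])
      then show "(\<lambda>x. f x * indicator K x) \<in> borel_measurable (lebesgue_on torus)"
        using f by (intro borel_measurable_times) auto
      show "AE x in lebesgue_on torus. norm (f x * complex_of_real (g n (E x))) \<le> cmod (f x)" for n
        using gE[of n] by (intro AE_I2) (auto simp: norm_mult intro!: mult_left_le)
      show "AE x in lebesgue_on torus. (\<lambda>n. f x * complex_of_real (g n (E x))) \<longlonglongrightarrow> f x * indicator K x"
      proof (rule AE_I2)
        fix x :: "real ^ 'd" assume "x \<in> space (lebesgue_on torus)"
        then have x: "x \<in> torus" by simp
        have "(\<lambda>n. g n (E x)) \<longlonglongrightarrow> indicator K x"
        proof (cases "x \<in> K")
          case True
          then have "infdist (E x) C = 0" by (simp add: C_def)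
          then show ?thesis using True by (simp add: g_def)
        next
          case False
          have "E x \<notin> C"
            using False injE[OF x] K by (auto simp: C_def)
          then have "infdist (E x) C > 0" using C infdist_nonneg[of "E x" C]
            by (metis in_closed_iff_infdist_zero less_eq_real_def)
          then have "(\<lambda>n. max 0 (1 - real n * infdist (E x) C)) \<longlonglongrightarrow> 0" by real_asymp
          then show ?thesis using False by (simp add: g_def)
        qed
        then have "(\<lambda>n. f x * complex_of_real (g n (E x))) \<longlonglongrightarrow> f x * complex_of_real (indicator K x)"
          by (intro tendsto_intros)
        then show "(\<lambda>n. f x * complex_of_real (g n (E x))) \<longlonglongrightarrow> f x * indicator K x"
          by (cases "x \<in> K") simp_all
      qed
    qed
    moreover have "(LINT x | lebesgue_on torus. f x * complex_of_real (g n (E x))) = 0" for n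
      by (rule cont0[OF gc])
    ultimately show ?thesis by (simp add: LIMSEQ_const_iff)
  qed
  have le: "AE x in lebesgue_on torus. Re (c * f x) \<le> 0" for c
  proof (rule AE_zero_of_compact_integrals)
    fix K :: "(real ^ 'd) set" assume K: "compact K" "K \<subseteq> torus"
    have fi: "integrable (lebesgue_on torus) (\<lambda>x. f x * indicator K x)"
      using f borel_compact[OF K(1)]
      by (intro integrable_mult_bounded[where B = 1] borel_measurable_lebesgue_on borel_measurable_indicator)
        (auto simp: indicator_def)
    have "(LINT x | lebesgue_on torus. Re (c * f x) * indicator K x)
        = (LINT x | lebesgue_on torus. Re (c * (f x * indicator K x)))"
      by (intro Bochner_Integration.integral_cong) (auto simp: indicator_def)
    also have "\<dots> = Re (LINT x | lebesgue_on torus. c * (f x * indicator K x))"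
      using fi by (intro integral_Re) auto
    also have "\<dots> = 0" using comp[OF K] by simp
    finally show "(LINT x | lebesgue_on torus. Re (c * f x) * indicator K x) = 0" .
  qed (use f bounded_torus in auto)
  \<comment> \<open>Rotating by 1, -1, i and -i turns the one-sided bound into vanishing real and
    imaginary parts.\<close>
  show ?thesis
    using le[of 1] le[of "-1"] le[of \<i>] le[of "- \<i>"] by eventually_elim (auto simp: complex_eq_iff)
qed

section \<open>The upper bound\<close>

lemma L2_torus_integrable:
  assumes "f \<in> L2_torus"
  shows "integrable (lebesgue_on torus) f"
proof (rule Bochner_Integration.integrable_bound)
  show "integrable (lebesgue_on torus) (\<lambda>x. 1 + (cmod (f x))\<^sup>2)"
    using assms by (intro Bochner_Integration.integrable_add finite_measure.integrable_const[OF finite_measure_torus])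
      (simp add: L2_torus_def)
  have "y \<le> 1 + y\<^sup>2" if "y \<ge> 0" for y :: real
    using zero_le_power2[of "y - 1"] that by (simp add: power2_eq_square algebra_simps)
  then show "AE x in lebesgue_on torus. norm (f x) \<le> norm (1 + (cmod (f x))\<^sup>2)"
    by (intro AE_I2) (simp add: abs_of_nonneg)
qed (use assms in \<open>simp add: L2_torus_def\<close>)

lemma H_space_integrable: "f \<in> H_space s r \<Longrightarrow> integrable (lebesgue_on torus) f"
  by (simp add: H_space_def L2_torus_integrable)

lemma fourier_coeff_linear:
  assumes "integrable (lebesgue_on torus) f" "integrable (lebesgue_on torus) g"
  shows "fourier_coeff (\<lambda>y. a * f y + b * g y) k = a * fourier_coeff f k + b * fourier_coeff g k"
proof -
  have "(LINT x | lebesgue_on torus. (a * f x + b * g x) * character (- k) x)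
      = (LINT x | lebesgue_on torus. a * (f x * character (- k) x) + b * (g x * character (- k) x))"
    by (simp add: algebra_simps)
  also have "\<dots> = a * (LINT x | lebesgue_on torus. f x * character (- k) x)
      + b * (LINT x | lebesgue_on torus. g x * character (- k) x)"
    using assms by (subst Bochner_Integration.integral_add) (auto intro: integrable_mult_character)
  finally show ?thesis by (simp add: fourier_coeff_character algebra_simps)
qed

lemma fourier_coeff_sum:
  assumes "finite I" "\<And>i. i \<in> I \<Longrightarrow> integrable (lebesgue_on torus) (f i)"
  shows "fourier_coeff (\<lambda>y. \<Sum>i\<in>I. a i * f i y) k = (\<Sum>i\<in>I. a i * fourier_coeff (f i) k)"
proof -
  have "(LINT x | lebesgue_on torus. (\<Sum>i\<in>I. a i * f i x) * character (- k) x)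
      = (LINT x | lebesgue_on torus. (\<Sum>i\<in>I. a i * (f i x * character (- k) x)))"
    by (simp add: sum_distrib_right mult.assoc)
  also have "\<dots> = (\<Sum>i\<in>I. a i * (LINT x | lebesgue_on torus. f i x * character (- k) x))"
    using assms by (subst Bochner_Integration.integral_sum) (auto simp: integrable_mult_character)
  finally show ?thesis by (simp add: fourier_coeff_character sum_distrib_left mult.left_commute)
qed

lemma Linf_norm_le:
  assumes "g \<in> borel_measurable (lebesgue_on torus)" "AE x in lebesgue_on torus. cmod (g x) \<le> B"
  shows "Linf_norm g \<le> ereal B"
  unfolding Linf_norm_def using assms by (intro esssup_I) auto

text \<open>Turns the unordered sum over the lattice into a series along \<open>e\<close>, the form
  in which tails make sense.\<close>

lemma H_norm_sums:
  fixes e :: "nat \<Rightarrow> int ^ 'd"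
  assumes f: "f \<in> H_space s r" and e: "bij e"
  shows "(\<lambda>j. sob_terms s r f (e j)) sums (H_norm s r f)\<^sup>2"
proof -
  have nonneg: "sob_terms s r f k \<ge> 0" for k by (simp add: sob_terms_def)
  have s: "(\<lambda>j. sob_terms s r f (e j)) summable_on UNIV"
    using f summable_on_reindex_bij_betw[OF e, of "sob_terms s r f"] by (simp add: H_space_def)
  have "(H_norm s r f)\<^sup>2 = (\<Sum>\<^sub>\<infinity>j. sob_terms s r f (e j))"
    using infsum_reindex_bij_betw[OF e, of "sob_terms s r f"] nonneg by (simp add: H_norm_def infsum_nonneg)
  moreover have "(\<lambda>j. sob_terms s r f (e j)) sums (\<Sum>\<^sub>\<infinity>j. sob_terms s r f (e j))"
    using has_sum_imp_sums[OF has_sum_infsum[OF s]] .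
  ultimately show ?thesis by simp
qed

lemma suminf_Cauchy_Schwarz:
  fixes a b :: "nat \<Rightarrow> real"
  assumes a: "summable (\<lambda>j. (a j)\<^sup>2)" and b: "summable (\<lambda>j. (b j)\<^sup>2)" and nn: "\<And>j. a j \<ge> 0" "\<And>j. b j \<ge> 0"
  shows "summable (\<lambda>j. a j * b j)" and "(\<Sum>j. a j * b j) \<le> sqrt (\<Sum>j. (a j)\<^sup>2) * sqrt (\<Sum>j. (b j)\<^sup>2)"
proof -
  have le: "(\<Sum>j<n. a j * b j) \<le> sqrt (\<Sum>j. (a j)\<^sup>2) * sqrt (\<Sum>j. (b j)\<^sup>2)" for n
  proof -
    have "(\<Sum>j<n. a j * b j)\<^sup>2 \<le> (\<Sum>j<n. (a j)\<^sup>2) * (\<Sum>j<n. (b j)\<^sup>2)" by (rule Cauchy_Schwarz_ineq_sum)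
    also have "\<dots> \<le> (\<Sum>j. (a j)\<^sup>2) * (\<Sum>j. (b j)\<^sup>2)"
      using a b by (intro mult_mono sum_le_suminf) (auto intro: suminf_nonneg sum_nonneg)
    finally show ?thesis by (simp add: real_le_rsqrt real_sqrt_mult[symmetric])
  qed
  show sm: "summable (\<lambda>j. a j * b j)"
    by (rule bounded_imp_summable[where B = "sqrt (\<Sum>j. (a j)\<^sup>2) * sqrt (\<Sum>j. (b j)\<^sup>2)"])
      (use nn le[of "Suc _"] in \<open>auto simp: lessThan_Suc_atMost\<close>)
  show "(\<Sum>j. a j * b j) \<le> sqrt (\<Sum>j. (a j)\<^sup>2) * sqrt (\<Sum>j. (b j)\<^sup>2)"
    by (rule suminf_le_const[OF sm le])
qed

context
  fixes s :: real and r :: ereal and e :: "nat \<Rightarrow> int ^ 'd" and \<sigma> :: "nat \<Rightarrow> real"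
  assumes r: "0 < r" and e: "bij e"
    and summ: "summable (\<lambda>j. (\<sigma> j)\<^sup>2)" and \<sigma>: "\<And>j. \<sigma> j = 1 / sob_weight s r (e j)"
begin

text \<open>Write the modulus of the coefficient as \<open>\<sigma> j * t j\<close>, where the
  squares of \<open>t j\<close> are the terms of the Sobolev norm, and apply Cauchy-Schwarz to the
  tail. With n = 0 this gives absolute convergence of the Fourier series.\<close>

lemma fourier_tail_bound:
  assumes f: "f \<in> H_space s r"
  shows "summable (\<lambda>j. cmod (fourier_coeff f (e (j + n))))"
    and "(\<Sum>j. cmod (fourier_coeff f (e (j + n)))) \<le> sqrt (\<Sum>j. (\<sigma> (j + n))\<^sup>2) * H_norm s r f"
proof -
  define t where "t j = sob_weight s r (e j) * cmod (fourier_coeff f (e j))" for j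
  have t2: "(t j)\<^sup>2 = sob_terms s r f (e j)" for j by (simp add: t_def sob_terms_def power_mult_distrib)
  have w: "sob_weight s r (e j) > 0" for j by (rule sob_weight_pos[OF r])
  have \<sigma>t: "\<sigma> j * t j = cmod (fourier_coeff f (e j))" for j using w[of j] by (simp add: \<sigma> t_def)
  have nn: "\<sigma> j \<ge> 0" "t j \<ge> 0" for j using w[of j] by (auto simp: \<sigma> t_def)
  have ts: "(\<lambda>j. (t j)\<^sup>2) sums (H_norm s r f)\<^sup>2" using H_norm_sums[OF f e] by (simp add: t2)
  have tn: "summable (\<lambda>j. (t (j + n))\<^sup>2)" and \<sigma>n: "summable (\<lambda>j. (\<sigma> (j + n))\<^sup>2)"
    using ts summ summable_iff_shift[of "\<lambda>j. (t j)\<^sup>2" n] summable_iff_shift[of "\<lambda>j. (\<sigma> j)\<^sup>2" n]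
    by (auto simp: sums_iff)
  note cs = suminf_Cauchy_Schwarz[OF \<sigma>n tn nn(1) nn(2)]
  show "summable (\<lambda>j. cmod (fourier_coeff f (e (j + n))))" using cs(1) by (simp add: \<sigma>t)
  have "(\<Sum>j. (t (j + n))\<^sup>2) \<le> (H_norm s r f)\<^sup>2"
    using suminf_split_initial_segment[of "\<lambda>j. (t j)\<^sup>2" n] ts sum_nonneg[of "{..<n}" "\<lambda>j. (t j)\<^sup>2"]
    by (simp add: sums_iff)
  then have "sqrt (\<Sum>j. (t (j + n))\<^sup>2) \<le> H_norm s r f"
    by (intro real_le_lsqrt) (auto simp: H_norm_def sob_terms_def infsum_nonneg intro: suminf_nonneg tn)
  then have "sqrt (\<Sum>j. (\<sigma> (j + n))\<^sup>2) * sqrt (\<Sum>j. (t (j + n))\<^sup>2) \<le> sqrt (\<Sum>j. (\<sigma> (j + n))\<^sup>2) * H_norm s r f"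
    by (intro mult_left_mono) (auto intro: suminf_nonneg \<sigma>n)
  with cs(2) show "(\<Sum>j. cmod (fourier_coeff f (e (j + n)))) \<le> sqrt (\<Sum>j. (\<sigma> (j + n))\<^sup>2) * H_norm s r f"
    by (simp add: \<sigma>t)
qed

text \<open>The absolutely convergent series defines an integrable \<open>g\<close>. Integrating
  term by term, orthogonality gives it the coefficients of \<open>f\<close>, and uniqueness
  identifies the two.\<close>

lemma fourier_series_AE:
  assumes f: "f \<in> H_space s r"
  shows "AE x in lebesgue_on torus. f x = (\<Sum>j. fourier_coeff f (e j) * character (e j) x)"
proof -
  define c where "c j = fourier_coeff f (e j)" for j
  define g where "g x = (\<Sum>j. c j * character (e j) x)" for x
  have cs: "summable (\<lambda>j. cmod (c j))" using fourier_tail_bound(1)[OF f, of 0] by (simp add: c_def)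
  have gk: "integrable (lebesgue_on torus) (\<lambda>x. g x * character k x)
      \<and> (LINT x | lebesgue_on torus. g x * character k x)
        = (\<Sum>j. LINT x | lebesgue_on torus. c j * character (e j) x * character k x)" for k
  proof -
    have eq: "g x * character k x = (\<Sum>j. c j * character (e j) x * character k x)" for x
      unfolding g_def
      by (rule suminf_mult2) (rule summable_norm_cancel, simp add: norm_mult cs)
    have i: "integrable (lebesgue_on torus) (\<lambda>x. c j * character (e j) x * character k x)" for j
      by (rule integrable_mult_character) simp
    have a: "AE x in lebesgue_on torus. summable (\<lambda>j. norm (c j * character (e j) x * character k x))"
      by (simp add: norm_mult cs)
    have b: "summable (\<lambda>j. LINT x | lebesgue_on torus. norm (c j * character (e j) x * character k x))"
      by (simp add: norm_mult summable_mult cs)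
    show ?thesis unfolding eq using integrable_suminf[OF i a b] integral_suminf[OF i a b] by simp
  qed
  have gi: "integrable (lebesgue_on torus) g" using gk[of 0] by simp
  have fi: "integrable (lebesgue_on torus) f" by (rule H_space_integrable[OF f])
  have fg: "fourier_coeff g (e l) = c l" for l
  proof -
    have "complex_of_real (1 / (2 * pi) ^ CARD('d)) * (LINT x | lebesgue_on torus. c j * character (e j) x * character (- e l) x)
        = (if j = l then c l else 0)" for j
    proof -
      have "complex_of_real (1 / (2 * pi) ^ CARD('d)) * (LINT x | lebesgue_on torus. c j * character (e j) x * character (- e l) x)
          = fourier_coeff (\<lambda>x. c j * character (e j) x + 0 * character (e j) x) (e l)"
        by (simp add: fourier_coeff_character)
      also have "\<dots> = c j * (if e l = e j then 1 else 0)"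
        by (subst fourier_coeff_linear) (simp_all add: fourier_coeff_of_character)
      finally show ?thesis using e by (auto simp: bij_def inj_eq)
    qed
    note E = this
    have "fourier_coeff g (e l)
        = complex_of_real (1 / (2 * pi) ^ CARD('d)) * (\<Sum>j. LINT x | lebesgue_on torus. c j * character (e j) x * character (- e l) x)"
      using gk[of "- e l"] by (simp add: fourier_coeff_character)
    also have "\<dots> = (\<Sum>j. if j = l then c l else 0)"
    proof -
      \<comment> \<open>By orthogonality only the term j = l survives. Summability of the unscaled
        integrals, required for pulling the constant out, is recovered from this series by dividing
        by a nonzero constant.\<close>
      have sE: "(\<lambda>j. complex_of_real (1 / (2 * pi) ^ CARD('d)) * (LINT x | lebesgue_on torus. c j * character (e j) x * character (- e l) x))
          sums c l"
        unfolding E using sums_single[of l "\<lambda>_. c l"] by simp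
      have "complex_of_real (1 / (2 * pi) ^ CARD('d)) \<noteq> 0" by simp
      then have "summable (\<lambda>j. LINT x | lebesgue_on torus. c j * character (e j) x * character (- e l) x)"
        by (intro summable_mult_D[OF sums_summable[OF sE]])
      from suminf_mult[OF this, of "complex_of_real (1 / (2 * pi) ^ CARD('d))", symmetric] show ?thesis
        unfolding E .
    qed
    also have "\<dots> = c l" using sums_unique[OF sums_single[of l "\<lambda>_. c l"]] by simp
    finally show ?thesis .
  qed
  have "AE x in lebesgue_on torus. 1 * f x + (-1) * g x = 0"
  proof (rule fourier_uniqueness)
    fix k
    obtain l where "k = e l" using e by (metis bij_pointE)
    then show "fourier_coeff (\<lambda>x. 1 * f x + (-1) * g x) k = 0"
      by (subst fourier_coeff_linear[OF fi gi]) (simp add: fg c_def)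
  qed (use fi gi in auto)
  then show ?thesis by eventually_elim (simp add: g_def c_def)
qed

text \<open>The partial sum of \<open>n\<close> terms has rank at most \<open>n\<close>, which is
  strictly below \<open>Suc n\<close>. The remainder is bounded by the sum of the moduli of its
  coefficients, uniformly in \<open>x\<close>.\<close>

lemma approx_num_le: "approx_num TYPE('d) s r (Suc n) \<le> ereal (sqrt (\<Sum>j. (\<sigma> (j + n))\<^sup>2))"
proof -
  define A where "A f x = (\<Sum>j<n. fourier_coeff f (e j) * character (e j) x)" for f and x :: "real ^ 'd"
  have Am: "A f \<in> borel_measurable (lebesgue_on torus)" for f
    unfolding A_def[abs_def] by measurable
  have Ab: "cmod (A f x) \<le> sqrt (\<Sum>j. (\<sigma> j)\<^sup>2) * H_norm s r f" if f: "f \<in> H_space s r" for f x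
  proof -
    have "cmod (A f x) \<le> (\<Sum>j<n. cmod (fourier_coeff f (e j)))"
      unfolding A_def by (rule order_trans[OF norm_sum]) (simp add: norm_mult)
    also have "\<dots> \<le> (\<Sum>j. cmod (fourier_coeff f (e j)))"
      using fourier_tail_bound(1)[OF f, of 0] by (intro sum_le_suminf) auto
    finally show ?thesis using fourier_tail_bound(2)[OF f, of 0] by simp
  qed
  have AL: "Linf_norm (A f) \<le> ereal (sqrt (\<Sum>j. (\<sigma> j)\<^sup>2) * H_norm s r f)" if "f \<in> H_space s r" for f
    using Ab[OF that] by (intro Linf_norm_le Am) auto
  have chL: "character k \<in> Linf_torus" for k :: "int ^ 'd"
    using Linf_norm_le[of "character k" 1] by (auto simp: Linf_torus_def)
  have adm: "admissible_op s r (Suc n) A"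
    unfolding admissible_op_def
  proof (intro conjI ballI allI)
    fix f :: "real ^ 'd \<Rightarrow> complex" assume f: "f \<in> H_space s r"
    show "A f \<in> Linf_torus" using AL[OF f] Am by (auto simp: Linf_torus_def)
    fix g :: "real ^ 'd \<Rightarrow> complex" and a b :: complex assume g: "g \<in> H_space s r"
    show "AE x in lebesgue_on torus. A (\<lambda>y. a * f y + b * g y) x = a * A f x + b * A g x"
      by (intro AE_I2)
        (simp add: A_def fourier_coeff_linear H_space_integrable[OF f] H_space_integrable[OF g]
          distrib_right sum.distrib sum_distrib_left mult.assoc)
  next
    show "\<exists>C. \<forall>f\<in>H_space s r. Linf_norm (A f) \<le> ereal (C * H_norm s r f)" using AL by blast
    show "\<exists>m<Suc n. \<exists>G. (\<forall>j<m. G j \<in> Linf_torus) \<and>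
        (\<forall>f\<in>H_space s r. \<exists>c. AE x in lebesgue_on torus. A f x = (\<Sum>j<m. c j * G j x))"
    proof (intro exI[of _ n] exI[of _ "\<lambda>j. character (e j)"] conjI ballI)
      fix f :: "real ^ 'd \<Rightarrow> complex"
      show "\<exists>c. AE x in lebesgue_on torus. A f x = (\<Sum>j<n. c j * character (e j) x)"
        by (rule exI[of _ "\<lambda>j. fourier_coeff f (e j)"]) (simp add: A_def)
    qed (auto simp: chL)
  qed
  have "diff_op_norm s r A \<le> ereal (sqrt (\<Sum>j. (\<sigma> (j + n))\<^sup>2))"
    unfolding diff_op_norm_def
  proof (rule SUP_least, clarify)
    fix f :: "real ^ 'd \<Rightarrow> complex" assume f: "f \<in> H_space s r" and f1: "H_norm s r f \<le> 1"
    have "AE x in lebesgue_on torus. cmod (f x - A f x) \<le> sqrt (\<Sum>j. (\<sigma> (j + n))\<^sup>2)"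
      using fourier_series_AE[OF f]
    proof eventually_elim
      case (elim x)
      have sm: "summable (\<lambda>j. cmod (fourier_coeff f (e j) * character (e j) x))"
        using fourier_tail_bound(1)[OF f, of 0] by (simp add: norm_mult)
      have "f x - A f x = (\<Sum>j. fourier_coeff f (e (j + n)) * character (e (j + n)) x)"
        using suminf_split_initial_segment[OF summable_norm_cancel[OF sm], of n] by (simp add: elim A_def)
      also have "cmod \<dots> \<le> (\<Sum>j. cmod (fourier_coeff f (e (j + n)) * character (e (j + n)) x))"
        using fourier_tail_bound(1)[OF f, of n] by (intro summable_norm) (simp add: norm_mult)
      also have "\<dots> \<le> sqrt (\<Sum>j. (\<sigma> (j + n))\<^sup>2) * H_norm s r f"
        using fourier_tail_bound(2)[OF f, of n] by (simp add: norm_mult)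
      also have "\<dots> \<le> sqrt (\<Sum>j. (\<sigma> (j + n))\<^sup>2) * 1"
        using f1 summ summable_iff_shift[of "\<lambda>j. (\<sigma> j)\<^sup>2" n] by (intro mult_left_mono) (auto intro: suminf_nonneg)
      finally show ?case by simp
    qed
    then show "Linf_norm (\<lambda>x. f x - A f x) \<le> ereal (sqrt (\<Sum>j. (\<sigma> (j + n))\<^sup>2))"
      using H_space_integrable[OF f] Am[of f] by (intro Linf_norm_le borel_measurable_diff) auto
  qed
  then show ?thesis
    unfolding approx_num_def using adm by (intro INF_lower2[of A]) auto
qed

end

section \<open>Distance to operators of low rank\<close>

lemma cmod_diff_square: "(cmod (a - b))\<^sup>2 = (cmod a)\<^sup>2 - 2 * Re (a * cnj b) + (cmod b)\<^sup>2"
  unfolding cmod_power2 by (simp add: power2_eq_square algebra_simps)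

lemma mult_cnj_eq_cmod_square: "z * cnj z = complex_of_real ((cmod z)\<^sup>2)"
  by (rule complex_norm_square[symmetric])

text \<open>Pythagoras: \<open>\<alpha>\<close> holds the coefficients of the orthogonal projection
  of \<open>a\<close>, and any other choice \<open>d\<close> adds its squared distance from
  \<open>\<alpha>\<close>. The identity contains both Bessel's inequality and the optimality of the
  projection.\<close>

lemma orthonormal_projection_error:
  fixes h :: "nat \<Rightarrow> 'a \<Rightarrow> complex" and a :: "'a \<Rightarrow> complex" and d :: "nat \<Rightarrow> complex"
  assumes on: "\<And>i j. i < M \<Longrightarrow> j < M \<Longrightarrow> (\<Sum>l\<in>L. h i l * cnj (h j l)) = (if i = j then 1 else 0)"
  defines "\<alpha> \<equiv> \<lambda>i. \<Sum>l\<in>L. a l * cnj (h i l)"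
  shows "(\<Sum>l\<in>L. (cmod (a l - (\<Sum>i<M. d i * h i l)))\<^sup>2)
    = (\<Sum>l\<in>L. (cmod (a l))\<^sup>2) - (\<Sum>i<M. (cmod (\<alpha> i))\<^sup>2) + (\<Sum>i<M. (cmod (\<alpha> i - d i))\<^sup>2)"
proof -
  define p where "p l = (\<Sum>i<M. d i * h i l)" for l
  have ip: "(\<Sum>l\<in>L. b l * cnj (p l)) = (\<Sum>i<M. (\<Sum>l\<in>L. b l * cnj (h i l)) * cnj (d i))" for b
  proof -
    have "(\<Sum>l\<in>L. b l * cnj (p l)) = (\<Sum>l\<in>L. \<Sum>i<M. b l * cnj (h i l) * cnj (d i))"
      by (simp add: p_def sum_distrib_left mult_ac)
    also have "\<dots> = (\<Sum>i<M. \<Sum>l\<in>L. b l * cnj (h i l) * cnj (d i))" by (rule sum.swap)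
    finally show ?thesis by (simp add: sum_distrib_right)
  qed
  have ph: "(\<Sum>l\<in>L. p l * cnj (h i l)) = d i" if "i < M" for i
  proof -
    have "(\<Sum>l\<in>L. p l * cnj (h i l)) = (\<Sum>l\<in>L. \<Sum>j<M. d j * (h j l * cnj (h i l)))"
      by (simp add: p_def sum_distrib_right mult.assoc)
    also have "\<dots> = (\<Sum>j<M. d j * (\<Sum>l\<in>L. h j l * cnj (h i l)))"
      by (subst sum.swap) (simp add: sum_distrib_left)
    also have "\<dots> = (\<Sum>j<M. if j = i then d j else 0)"
      using that by (intro sum.cong) (auto simp: on)
    finally show ?thesis using that by simp
  qed
  have "(\<Sum>l\<in>L. (cmod (p l))\<^sup>2) = Re (\<Sum>l\<in>L. p l * cnj (p l))"
    by (simp add: mult_cnj_eq_cmod_square del: of_real_power)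
  also have "\<dots> = Re (\<Sum>i<M. d i * cnj (d i))" by (simp only: ip) (simp add: ph)
  also have "\<dots> = (\<Sum>i<M. (cmod (d i))\<^sup>2)"
    by (simp add: mult_cnj_eq_cmod_square del: of_real_power)
  finally have pp: "(\<Sum>l\<in>L. (cmod (p l))\<^sup>2) = (\<Sum>i<M. (cmod (d i))\<^sup>2)" .
  have "(\<Sum>l\<in>L. (cmod (a l - p l))\<^sup>2)
      = (\<Sum>l\<in>L. (cmod (a l))\<^sup>2) - 2 * Re (\<Sum>l\<in>L. a l * cnj (p l)) + (\<Sum>l\<in>L. (cmod (p l))\<^sup>2)"
    by (simp only: cmod_diff_square sum.distrib sum_subtractf Re_sum sum_distrib_left)
  also have "Re (\<Sum>l\<in>L. a l * cnj (p l)) = (\<Sum>i<M. Re (\<alpha> i * cnj (d i)))"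
    by (simp only: ip \<alpha>_def Re_sum)
  finally show ?thesis
    by (simp add: pp cmod_diff_square sum.distrib sum_subtractf sum_distrib_left p_def[symmetric])
qed

text \<open>Gram-Schmidt for vectors indexed by \<open>L\<close>. Dependent vectors are skipped, so
  the orthonormal system may be shorter than \<open>m\<close>; only its span and the bound on its
  length matter later.\<close>

lemma gram_schmidt_functions:
  fixes g :: "nat \<Rightarrow> 'a \<Rightarrow> complex"
  assumes L: "finite L"
  shows "\<exists>M h. M \<le> m \<and> (\<forall>i<M. \<forall>j<M. (\<Sum>l\<in>L. h i l * cnj (h j l)) = (if i = j then 1 else 0))
    \<and> (\<forall>j<m. \<exists>c. \<forall>l\<in>L. g j l = (\<Sum>i<M. c i * h i l))"
proof (induction m)
  case 0
  show ?case by (rule exI[of _ 0]) auto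
next
  case (Suc m)
  then obtain M h where M: "M \<le> m"
    and on: "\<And>i j. i < M \<Longrightarrow> j < M \<Longrightarrow> (\<Sum>l\<in>L. h i l * cnj (h j l)) = (if i = j then 1 else 0)"
    and sp: "\<And>j. j < m \<Longrightarrow> \<exists>c. \<forall>l\<in>L. g j l = (\<Sum>i<M. c i * h i l)" by blast
  define a where "a i = (\<Sum>l\<in>L. g m l * cnj (h i l))" for i
  define v where "v l = g m l - (\<Sum>i<M. a i * h i l)" for l
  define n2 where "n2 = (\<Sum>l\<in>L. (cmod (v l))\<^sup>2)"
  have vh: "(\<Sum>l\<in>L. v l * cnj (h j l)) = 0" if "j < M" for j
  proof -
    have "(\<Sum>l\<in>L. (\<Sum>i<M. a i * h i l) * cnj (h j l)) = (\<Sum>l\<in>L. \<Sum>i<M. a i * (h i l * cnj (h j l)))"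
      by (simp add: sum_distrib_right mult.assoc)
    also have "\<dots> = (\<Sum>i<M. a i * (\<Sum>l\<in>L. h i l * cnj (h j l)))"
      by (subst sum.swap) (simp add: sum_distrib_left)
    also have "\<dots> = (\<Sum>i<M. if i = j then a i else 0)" using that by (intro sum.cong) (auto simp: on)
    also have "\<dots> = a j" using that by simp
    finally show ?thesis by (simp add: v_def left_diff_distrib sum_subtractf a_def)
  qed
  show ?case
  proof (cases "n2 = 0")
    case True
    then have "\<forall>l\<in>L. v l = 0" using L by (simp add: n2_def sum_nonneg_eq_0_iff)
    then have "\<forall>l\<in>L. g m l = (\<Sum>i<M. a i * h i l)" by (simp add: v_def)
    then have "\<forall>j<Suc m. \<exists>c. \<forall>l\<in>L. g j l = (\<Sum>i<M. c i * h i l)" using sp by (auto simp: less_Suc_eq)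
    then show ?thesis using M on by (intro exI[of _ M] exI[of _ h]) auto
  next
    case False
    then have n2: "n2 > 0" using sum_nonneg[of L "\<lambda>l. (cmod (v l))\<^sup>2"] unfolding n2_def by fastforce
    define h' where "h' = h(M := \<lambda>l. v l / complex_of_real (sqrt n2))"
    have h': "h' i = h i" if "i < M" for i using that by (simp add: h'_def)
    have h'M: "h' M l = v l / complex_of_real (sqrt n2)" for l by (simp add: h'_def)
    have sq: "complex_of_real (sqrt n2) * complex_of_real (sqrt n2) = complex_of_real n2"
      using n2 by (simp flip: of_real_mult)
    have vv: "(\<Sum>l\<in>L. h' M l * cnj (h' M l)) = 1"
    proof -
      have "h' M l * cnj (h' M l) = complex_of_real ((cmod (v l))\<^sup>2 / n2)" for l
        using n2 by (simp add: mult_cnj_eq_cmod_square h'M norm_divide power_divide sq del: of_real_power)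
      then have "(\<Sum>l\<in>L. h' M l * cnj (h' M l)) = complex_of_real (\<Sum>l\<in>L. (cmod (v l))\<^sup>2 / n2)"
        by (simp only: of_real_sum)
      also have "(\<Sum>l\<in>L. (cmod (v l))\<^sup>2 / n2) = 1"
        using n2 by (simp add: sum_divide_distrib[symmetric] n2_def[symmetric])
      finally show ?thesis by simp
    qed
    have vh': "(\<Sum>l\<in>L. h' M l * cnj (h j l)) = 0" if "j < M" for j
    proof -
      have "(\<Sum>l\<in>L. h' M l * cnj (h j l)) = (\<Sum>l\<in>L. v l * cnj (h j l)) / complex_of_real (sqrt n2)"
        by (simp add: h'M sum_divide_distrib)
      then show ?thesis using vh[OF that] by simp
    qed
    have hv': "(\<Sum>l\<in>L. h j l * cnj (h' M l)) = 0" if "j < M" for j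
    proof -
      have "(\<Sum>l\<in>L. h j l * cnj (h' M l)) = cnj (\<Sum>l\<in>L. h' M l * cnj (h j l))" by (simp add: mult.commute)
      then show ?thesis using vh'[OF that] by simp
    qed
    have "\<exists>c. \<forall>l\<in>L. g j l = (\<Sum>i<Suc M. c i * h' i l)" if "j < Suc m" for j
    proof (cases "j = m")
      case True
      have "g m l = (\<Sum>i<M. a i * h i l) + complex_of_real (sqrt n2) * h' M l" for l
        using n2 by (simp add: h'M v_def)
      then have "\<forall>l\<in>L. g j l = (\<Sum>i<Suc M. (a(M := complex_of_real (sqrt n2))) i * h' i l)"
        by (simp add: True h')
      then show ?thesis by blast
    next
      case False
      then obtain c where c: "\<forall>l\<in>L. g j l = (\<Sum>i<M. c i * h i l)" using sp[of j] \<open>j < Suc m\<close> by auto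
      then have "\<forall>l\<in>L. g j l = (\<Sum>i<Suc M. (c(M := 0)) i * h' i l)" by (simp add: h')
      then show ?thesis by blast
    qed
    moreover have "(\<Sum>l\<in>L. h' i l * cnj (h' j l)) = (if i = j then 1 else 0)" if "i < Suc M" "j < Suc M" for i j
      using that on[of i j] vv vh'[of j] hv'[of i] h' by (auto simp: less_Suc_eq)
    ultimately show ?thesis using M by (intro exI[of _ "Suc M"] exI[of _ h']) auto
  qed
qed

text \<open>Bathtub principle: a total mass of at most \<open>m\<close>, with at most 1 per index,
  removes the most from a decreasing sequence when it sits on the first \<open>m\<close>
  entries.\<close>

lemma sum_weights_ge_tail:
  fixes a p :: "nat \<Rightarrow> real"
  assumes a: "antimono a" "\<And>k. a k \<ge> 0" and p: "\<And>k. k < N \<Longrightarrow> 0 \<le> p k \<and> p k \<le> 1" and sp: "(\<Sum>k<N. p k) \<le> real m"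
  shows "(\<Sum>k\<in>{m..<N}. a k) \<le> (\<Sum>k<N. a k * (1 - p k))"
proof (cases "m < N")
  case False
  then show ?thesis using a p by (auto intro!: sum_nonneg mult_nonneg_nonneg)
next
  case True
  then have split: "{..<N} = {..<m} \<union> {m..<N}" by auto
  have S: "sum f {..<N} = sum f {..<m} + sum f {m..<N}" for f :: "nat \<Rightarrow> real"
    unfolding split by (rule sum.union_disjoint) auto
  \<comment> \<open>The threshold value \<open>a m\<close> is compared with both sides: entries
    before \<open>m\<close> are at least as large, later ones at most as large, so moving mass
    forward cannot raise the remaining sum.\<close>
  have "(\<Sum>k<m. a m * (1 - p k)) \<le> (\<Sum>k<m. a k * (1 - p k))"
    using p True antimonoD[OF a(1)] by (intro sum_mono mult_right_mono) auto
  moreover have "(\<Sum>k\<in>{m..<N}. a k * p k) \<le> (\<Sum>k\<in>{m..<N}. a m * p k)"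
    using p antimonoD[OF a(1)] by (intro sum_mono mult_right_mono) auto
  moreover have "a m * (\<Sum>k<N. p k) \<le> a m * real m" using sp a(2) by (intro mult_left_mono) auto
  ultimately show ?thesis
    unfolding S by (simp add: right_diff_distrib sum_subtractf sum_distrib_left[symmetric] distrib_left mult.commute[of "a m" "real m"])
qed

text \<open>The Eckart-Young bound for a diagonal matrix. Every row of the approximant lies in a
  space of dimension M at most \<open>m\<close>, so row \<open>k\<close> has squared error at least
  \<open>(\<sigma> k)\<^sup>2 * (1 - p k)\<close>. The bathtub principle then bounds the
  total.\<close>

lemma frobenius_distance_to_rank:
  fixes \<sigma> :: "nat \<Rightarrow> real" and c g :: "nat \<Rightarrow> nat \<Rightarrow> complex"
  assumes \<sigma>: "antimono \<sigma>" "\<And>k. \<sigma> k \<ge> 0"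
  shows "(\<Sum>k\<in>{m..<N}. (\<sigma> k)\<^sup>2)
    \<le> (\<Sum>k<N. \<Sum>l<N. (cmod ((if k = l then complex_of_real (\<sigma> k) else 0) - (\<Sum>j<m. c k j * g j l)))\<^sup>2)"
proof -
  obtain M h where M: "M \<le> m"
    and on: "\<And>i j. i < M \<Longrightarrow> j < M \<Longrightarrow> (\<Sum>l<N. h i l * cnj (h j l)) = (if i = j then 1 else 0)"
    and sp: "\<And>j. j < m \<Longrightarrow> \<exists>c. \<forall>l\<in>{..<N}. g j l = (\<Sum>i<M. c i * h i l)"
    using gram_schmidt_functions[of "{..<N}" m g] by (auto simp del: lessThan_iff)
  \<comment> \<open>\<open>p k\<close> is the squared norm of the projection of the \<open>k\<close>-th unit vector onto the span of the rows.\<close>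
  define p where "p k = (\<Sum>i<M. (cmod (h i k))\<^sup>2)" for k
  have err: "(\<Sum>l<N. (cmod ((if k = l then complex_of_real t else 0) - (\<Sum>i<M. d i * h i l)))\<^sup>2)
      = t\<^sup>2 - t\<^sup>2 * p k + (\<Sum>i<M. (cmod (complex_of_real t * cnj (h i k) - d i))\<^sup>2)" if k: "k < N" for k t d
  proof -
    have 1: "(\<Sum>l<N. (if k = l then complex_of_real t else 0) * cnj (h i l)) = complex_of_real t * cnj (h i k)" for i
      using k by (simp add: if_distrib if_distribR sum.delta cong: if_cong)
    have 2: "(\<Sum>l<N. (cmod (if k = l then complex_of_real t else 0))\<^sup>2) = t\<^sup>2"
      using k by (simp add: if_distrib if_distribR sum.delta cong: if_cong)
    show ?thesis
      using orthonormal_projection_error[where L = "{..<N}" and M = M and h = h and d = d and a = "\<lambda>l. if k = l then complex_of_real t else 0"] on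
      by (simp add: 1 2 p_def norm_mult power_mult_distrib sum_distrib_left)
  qed
  have p01: "0 \<le> p k \<and> p k \<le> 1" if "k < N" for k
  proof -
    \<comment> \<open>With t = 1 and the projection coefficients as \<open>d\<close>, the squared
      error of a unit vector is exactly \<open>1 - p k\<close>.\<close>
    have "0 \<le> (\<Sum>l<N. (cmod ((if k = l then complex_of_real 1 else 0) - (\<Sum>i<M. cnj (h i k) * h i l)))\<^sup>2)"
      by (intro sum_nonneg) auto
    also have "\<dots> = 1 - p k" using err[OF that, of 1 "\<lambda>i. cnj (h i k)"] by simp
    finally show ?thesis by (auto simp: p_def intro: sum_nonneg)
  qed
  \<comment> \<open>The trace of an orthogonal projection is its rank.\<close>
  have "(\<Sum>k<N. p k) = (\<Sum>i<M. \<Sum>k<N. (cmod (h i k))\<^sup>2)" unfolding p_def by (rule sum.swap)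
  also have "\<dots> = (\<Sum>i<M. 1)"
  proof (rule sum.cong[OF refl])
    fix i assume "i \<in> {..<M}"
    then have "complex_of_real (\<Sum>k<N. (cmod (h i k))\<^sup>2) = 1"
      using on[of i i] by (simp add: mult_cnj_eq_cmod_square)
    then show "(\<Sum>k<N. (cmod (h i k))\<^sup>2) = 1" by (metis of_real_eq_1_iff)
  qed
  finally have psum: "(\<Sum>k<N. p k) \<le> real m" using M by simp
  have "antimono (\<lambda>k. (\<sigma> k)\<^sup>2)" using \<sigma> by (auto simp: antimono_def intro: power_mono)
  then have "(\<Sum>k\<in>{m..<N}. (\<sigma> k)\<^sup>2) \<le> (\<Sum>k<N. (\<sigma> k)\<^sup>2 * (1 - p k))"
    using p01 psum by (intro sum_weights_ge_tail) auto
  also have "\<dots> \<le> (\<Sum>k<N. \<Sum>l<N. (cmod ((if k = l then complex_of_real (\<sigma> k) else 0) - (\<Sum>j<m. c k j * g j l)))\<^sup>2)"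
  proof (rule sum_mono)
    fix k assume k: "k \<in> {..<N}"
    obtain b where b: "\<And>j l. j < m \<Longrightarrow> l < N \<Longrightarrow> g j l = (\<Sum>i<M. b j i * h i l)"
      using sp by (metis lessThan_iff)
    \<comment> \<open>Coefficients of the \<open>k\<close>-th row of the approximant in the
      orthonormal system \<open>h\<close>.\<close>
    define d where "d i = (\<Sum>j<m. c k j * b j i)" for i
    have "(\<Sum>j<m. c k j * g j l) = (\<Sum>i<M. d i * h i l)" if "l < N" for l
    proof -
      have "(\<Sum>j<m. c k j * g j l) = (\<Sum>j<m. \<Sum>i<M. c k j * b j i * h i l)"
        using b that by (simp add: sum_distrib_left mult.assoc)
      also have "\<dots> = (\<Sum>i<M. d i * h i l)" by (subst sum.swap) (simp add: d_def sum_distrib_right)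
      finally show ?thesis .
    qed
    then have "(\<Sum>l<N. (cmod ((if k = l then complex_of_real (\<sigma> k) else 0) - (\<Sum>j<m. c k j * g j l)))\<^sup>2)
      = (\<Sum>l<N. (cmod ((if k = l then complex_of_real (\<sigma> k) else 0) - (\<Sum>i<M. d i * h i l)))\<^sup>2)" by simp
    also have "\<dots> \<ge> (\<sigma> k)\<^sup>2 * (1 - p k)"
      using k by (subst err) (auto simp: right_diff_distrib intro!: sum_nonneg)
    finally show "(\<sigma> k)\<^sup>2 * (1 - p k)
      \<le> (\<Sum>l<N. (cmod ((if k = l then complex_of_real (\<sigma> k) else 0) - (\<Sum>j<m. c k j * g j l)))\<^sup>2)" .
  qed
  finally show ?thesis .
qed

section \<open>The lower bound\<close>

text \<open>The integral of \<open>\<bar>g - P\<bar>^2\<close> is nonnegative for the partial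
  Fourier sum \<open>P\<close>. Integrals here are with respect to unnormalised Lebesgue measure,
  whence the factor (2 pi)^d.\<close>

lemma bessel_torus:
  fixes g :: "real ^ 'd \<Rightarrow> complex"
  assumes g: "g \<in> borel_measurable (lebesgue_on torus)" "AE x in lebesgue_on torus. cmod (g x) \<le> B" and F: "finite F"
  shows "(2 * pi) ^ CARD('d) * (\<Sum>k\<in>F. (cmod (fourier_coeff g k))\<^sup>2) \<le> (LINT x | lebesgue_on torus. (cmod (g x))\<^sup>2)"
proof -
  define c where "c k = fourier_coeff g k" for k
  define P where "P x = (\<Sum>k\<in>F. c k * character k x)" for x
  define V where "V = (2 * pi) ^ CARD('d)"
  have V: "V > 0" by (simp add: V_def)
  have gi: "integrable (lebesgue_on torus) g" by (rule integrable_bounded_torus[OF g])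
  have Pi: "integrable (lebesgue_on torus) P" unfolding P_def[abs_def] by simp
  have ip: "integrable (lebesgue_on torus) (\<lambda>x. h x * cnj (P x))
      \<and> (LINT x | lebesgue_on torus. h x * cnj (P x)) = complex_of_real V * (\<Sum>k\<in>F. cnj (c k) * fourier_coeff h k)"
    if h: "integrable (lebesgue_on torus) h" for h
  proof -
    have eq: "h x * cnj (P x) = (\<Sum>k\<in>F. cnj (c k) * (h x * character (- k) x))" for x
      by (simp add: P_def sum_distrib_left cnj_character mult_ac)
    have "(LINT x | lebesgue_on torus. h x * character (- k) x) = complex_of_real V * fourier_coeff h k" for k
      by (simp add: fourier_coeff_character V_def)
    then show ?thesis
      unfolding eq using h F
      by (subst Bochner_Integration.integral_sum)
        (auto simp: integrable_mult_character sum_distrib_left mult.left_commute[of _ "complex_of_real V"]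
          intro!: Bochner_Integration.integrable_sum)
  qed
  have ck: "fourier_coeff P k = c k" if "k \<in> F" for k
    unfolding P_def[abs_def] using F that
    by (subst fourier_coeff_sum) (auto simp: fourier_coeff_of_character if_distrib sum.delta cong: if_cong)
  define T where "T = (\<Sum>k\<in>F. (cmod (c k))\<^sup>2)"
  have T: "(\<Sum>k\<in>F. cnj (c k) * c k) = complex_of_real T"
    by (simp add: T_def mult.commute[of "cnj _"] mult_cnj_eq_cmod_square)
  have gP: "(LINT x | lebesgue_on torus. g x * cnj (P x)) = complex_of_real (V * T)"
    using ip[OF gi] T by (simp add: c_def)
  have PP: "(LINT x | lebesgue_on torus. P x * cnj (P x)) = complex_of_real (V * T)"
    using ip[OF Pi] T by (simp add: ck)
  have Pint: "integrable (lebesgue_on torus) (\<lambda>x. (cmod (P x))\<^sup>2)"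
    and PP': "(LINT x | lebesgue_on torus. (cmod (P x))\<^sup>2) = V * T"
  proof -
    have eq: "(cmod (P x))\<^sup>2 = Re (P x * cnj (P x))" for x by (simp add: mult_cnj_eq_cmod_square del: of_real_power)
    show "integrable (lebesgue_on torus) (\<lambda>x. (cmod (P x))\<^sup>2)"
      unfolding eq by (rule integrable_Re[OF conjunct1[OF ip[OF Pi]]])
    show "(LINT x | lebesgue_on torus. (cmod (P x))\<^sup>2) = V * T"
      unfolding eq using ip[OF Pi] PP by (subst integral_Re) auto
  qed
  have gint: "integrable (lebesgue_on torus) (\<lambda>x. (cmod (g x))\<^sup>2)"
    by (rule finite_measure.integrable_const_bound[OF finite_measure_torus, where B = "B\<^sup>2"])
      (use g in \<open>auto elim!: eventually_mono intro: power_mono\<close>)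
  define q where "q x = Re (g x * cnj (P x))" for x
  have qint: "integrable (lebesgue_on torus) q"
    unfolding q_def[abs_def] by (rule integrable_Re[OF conjunct1[OF ip[OF gi]]])
  have gP': "(LINT x | lebesgue_on torus. q x) = V * T"
    unfolding q_def using ip[OF gi] gP by (subst integral_Re) auto
  have "0 \<le> (LINT x | lebesgue_on torus. (cmod (g x - P x))\<^sup>2)" by simp
  also have "\<dots> = (LINT x | lebesgue_on torus. (cmod (g x))\<^sup>2 - 2 * q x + (cmod (P x))\<^sup>2)"
    by (simp only: cmod_diff_square q_def)
  also have "\<dots> = (LINT x | lebesgue_on torus. (cmod (g x))\<^sup>2) - 2 * (V * T) + V * T"
    using gint qint Pint by (simp add: gP' PP')
  finally have "V * T \<le> (LINT x | lebesgue_on torus. (cmod (g x))\<^sup>2)" by (simp add: mult.commute)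
  then show ?thesis by (simp only: T_def V_def c_def)
qed

text \<open>The torus is not a null set. This keeps an essential supremum of moduli from being
  negative, in particular from being -\<infinity>.\<close>

lemma not_AE_False_torus: "\<not> (AE x in lebesgue_on (torus :: (real ^ 'd) set). False)"
proof
  assume "AE x in lebesgue_on (torus :: (real ^ 'd) set). False"
  then have "(LINT x | lebesgue_on (torus :: (real ^ 'd) set). character 0 x) = (LINT x | lebesgue_on (torus :: (real ^ 'd) set). 0)"
    by (intro integral_cong_AE) (auto elim: eventually_mono)
  then show False using integral_character[of "0 :: int ^ 'd"] by simp
qed

lemma Linf_torus_bounded:
  assumes "g \<in> Linf_torus"
  obtains B where "AE x in lebesgue_on torus. cmod (g x) \<le> B"
proof -
  have ae: "AE x in lebesgue_on torus. ereal (cmod (g x)) \<le> Linf_norm g"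
    unfolding Linf_norm_def by (rule esssup_AE)
  show ?thesis
  proof (cases "Linf_norm g")
    case (real B)
    then show ?thesis using ae that[of B] by simp
  next
    case PInf
    then show ?thesis using assms by (simp add: Linf_torus_def)
  next
    case MInf
    then show ?thesis using ae by (simp add: not_AE_False_torus)
  qed
qed

lemma fourier_coeff_cong_AE:
  fixes f g :: "real ^ 'd \<Rightarrow> complex"
  assumes "f \<in> borel_measurable (lebesgue_on torus)" "g \<in> borel_measurable (lebesgue_on torus)"
    and "AE x in lebesgue_on torus. f x = g x"
  shows "fourier_coeff f k = fourier_coeff g k"
proof -
  have "(LINT x | lebesgue_on torus. f x * character (- k) x) = (LINT x | lebesgue_on torus. g x * character (- k) x)"
    using assms by (intro integral_cong_AE) (auto elim: eventually_mono)
  then show ?thesis by (simp add: fourier_coeff_character)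
qed

lemma Linf_norm_nonneg:
  fixes g :: "real ^ 'a \<Rightarrow> complex"
  shows "Linf_norm g \<ge> 0"
proof (rule ccontr)
  assume neg: "\<not> 0 \<le> Linf_norm g"
  have "AE x in lebesgue_on torus. ereal (cmod (g x)) \<le> Linf_norm g"
    unfolding Linf_norm_def by (rule esssup_AE)
  then have "AE x in lebesgue_on (torus :: (real ^ 'a) set). False"
  proof eventually_elim
    case (elim x)
    have "0 \<le> ereal (cmod (g x))" by simp
    then show ?case using elim neg order_trans by blast
  qed
  then show False using not_AE_False_torus by blast
qed

text \<open>The exceptional null set in the hypothesis depends on \<open>c\<close>, while the proof needs the coefficients
  \<open>c k = cnj (T k x)\<close>, which depend on \<open>x\<close>. Hence the detour through a countable dense set of
  coefficients.\<close>

lemma sum_squares_AE_le: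
  fixes T :: "nat \<Rightarrow> 'a \<Rightarrow> complex"
  assumes D: "D \<ge> 0"
    and le: "\<And>c. AE x in M. cmod (\<Sum>k<N. c k * T k x) \<le> D * sqrt (\<Sum>k<N. (cmod (c k))\<^sup>2)"
  shows "AE x in M. (\<Sum>k<N. (cmod (T k x))\<^sup>2) \<le> D\<^sup>2"
proof -
  obtain Q :: "complex set" where Q: "countable Q" "\<And>X. open X \<Longrightarrow> X \<noteq> {} \<Longrightarrow> \<exists>q\<in>Q. q \<in> X"
    using countable_dense_setE by blast
  have dense: "z \<in> closure Q" for z
    using Q(2) unfolding closure_iff_nhds_not_empty by (metis Int_iff empty_iff subsetD)
  have "countable (PiE {..<N} (\<lambda>_. Q))" using Q(1) by (intro countable_PiE) auto
  then have "AE x in M. \<forall>c\<in>PiE {..<N} (\<lambda>_. Q). cmod (\<Sum>k<N. c k * T k x) \<le> D * sqrt (\<Sum>k<N. (cmod (c k))\<^sup>2)"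
    using le by (subst AE_ball_countable) auto
  then show ?thesis
  proof eventually_elim
    case (elim x)
    define S where "S = (\<Sum>k<N. (cmod (T k x))\<^sup>2)"
    have S0: "S \<ge> 0" by (simp add: S_def sum_nonneg)
    have "\<exists>q. (\<forall>n. q n \<in> Q) \<and> q \<longlonglongrightarrow> cnj (T k x)" for k
      using dense[of "cnj (T k x)"] by (simp add: closure_sequential)
    then obtain q where q: "\<And>k n. q k n \<in> Q" "\<And>k. q k \<longlonglongrightarrow> cnj (T k x)" by metis
    have "cmod (\<Sum>k<N. q k n * T k x) \<le> D * sqrt (\<Sum>k<N. (cmod (q k n))\<^sup>2)" for n
      using elim[rule_format, of "restrict (\<lambda>k. q k n) {..<N}"] q(1) by auto
    moreover have "(\<lambda>n. cmod (\<Sum>k<N. q k n * T k x)) \<longlonglongrightarrow> cmod (\<Sum>k<N. cnj (T k x) * T k x)"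
      by (intro tendsto_intros q)
    moreover have "(\<lambda>n. D * sqrt (\<Sum>k<N. (cmod (q k n))\<^sup>2)) \<longlonglongrightarrow> D * sqrt (\<Sum>k<N. (cmod (cnj (T k x)))\<^sup>2)"
      by (intro tendsto_intros q)
    ultimately have lim: "cmod (\<Sum>k<N. cnj (T k x) * T k x) \<le> D * sqrt (\<Sum>k<N. (cmod (cnj (T k x)))\<^sup>2)"
      using LIMSEQ_le by blast
    have "(\<Sum>k<N. cnj (T k x) * T k x) = complex_of_real S"
      by (simp add: S_def mult.commute[of "cnj _"] mult_cnj_eq_cmod_square)
    \<comment> \<open>For the conjugate coefficients the linear form equals the sum of squares
      \<open>S\<close>, while their Euclidean norm is the root of \<open>S\<close>.\<close>
    with lim have "cmod (complex_of_real S) \<le> D * sqrt S" by (simp only: complex_mod_cnj S_def[symmetric])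
    then have "S \<le> D * sqrt S" using S0 by simp
    then have "sqrt S * sqrt S \<le> D * sqrt S" using S0 by simp
    then have "sqrt S \<le> D" using S0 D mult_right_le_imp_le[of "sqrt S" "sqrt S" D] by (cases "S = 0") auto
    then have "(sqrt S)\<^sup>2 \<le> D\<^sup>2" using S0 by (intro power_mono) auto
    then show ?case using S0 by (simp add: S_def)
  qed
qed

context
  fixes s :: real and r :: ereal and e :: "nat \<Rightarrow> int ^ 'd" and \<sigma> :: "nat \<Rightarrow> real"
  assumes r: "0 < r" and e: "bij e"
    and \<sigma>: "\<And>j. \<sigma> j = 1 / sob_weight s r (e j)"
begin

text \<open>The factor \<open>\<sigma> k\<close> makes the summands orthonormal for the Sobolev
  inner product, so the Sobolev norm of a combination is the Euclidean norm of
  \<open>c\<close>.\<close>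

definition basis_comb :: "nat \<Rightarrow> (nat \<Rightarrow> complex) \<Rightarrow> real ^ 'd \<Rightarrow> complex" where
  "basis_comb N c x = (\<Sum>k<N. c k * (complex_of_real (\<sigma> k) * character (e k) x))"

lemma \<sigma>_pos: "\<sigma> j > 0"
  using sob_weight_pos[OF r, of s "e j"] by (simp add: \<sigma>)

lemma fourier_coeff_basis_comb:
  "fourier_coeff (basis_comb N c) (e l) = (if l < N then c l * complex_of_real (\<sigma> l) else 0)"
proof -
  have "fourier_coeff (basis_comb N c) (e l) = fourier_coeff (\<lambda>x. \<Sum>k<N. (c k * complex_of_real (\<sigma> k)) * character (e k) x) (e l)"
    unfolding basis_comb_def[abs_def] by (simp add: mult.assoc)
  also have "\<dots> = (\<Sum>k<N. (c k * complex_of_real (\<sigma> k)) * fourier_coeff (character (e k)) (e l))"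
    by (rule fourier_coeff_sum) auto
  also have "\<dots> = (\<Sum>k<N. if k = l then c k * complex_of_real (\<sigma> k) else 0)"
    using e by (intro sum.cong) (auto simp: fourier_coeff_of_character bij_def inj_eq)
  finally show ?thesis by (simp add: sum.delta)
qed

lemma basis_comb_H_space:
  shows "basis_comb N c \<in> H_space s r" and "H_norm s r (basis_comb N c) = sqrt (\<Sum>k<N. (cmod (c k))\<^sup>2)"
proof -
  have terms: "sob_terms s r (basis_comb N c) (e l) = (if l < N then (cmod (c l))\<^sup>2 else 0)" for l
  proof -
    have "sob_weight s r (e l) * \<sigma> l = 1" using sob_weight_pos[OF r, of s "e l"] by (simp add: \<sigma>)
    then have "(sob_weight s r (e l))\<^sup>2 * (\<sigma> l)\<^sup>2 = 1" by (simp flip: power_mult_distrib)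
    then show ?thesis
      by (simp add: sob_terms_def fourier_coeff_basis_comb norm_mult power_mult_distrib)
  qed
  have m: "basis_comb N c \<in> borel_measurable (lebesgue_on torus)"
    unfolding basis_comb_def[abs_def] by measurable
  have b: "cmod (basis_comb N c x) \<le> (\<Sum>k<N. cmod (c k) * \<sigma> k)" for x
    unfolding basis_comb_def using \<sigma>_pos
    by (intro order_trans[OF norm_sum]) (simp add: norm_mult abs_of_pos)
  have "integrable (lebesgue_on torus) (\<lambda>x. (cmod (basis_comb N c x))\<^sup>2)"
    by (rule finite_measure.integrable_const_bound[OF finite_measure_torus, where B = "(\<Sum>k<N. cmod (c k) * \<sigma> k)\<^sup>2"])
      (use m in \<open>auto intro!: AE_I2 power_mono b\<close>)
  with m have L2: "basis_comb N c \<in> L2_torus" by (simp add: L2_torus_def)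
  have "(\<lambda>l. sob_terms s r (basis_comb N c) (e l)) summable_on UNIV"
    unfolding terms by (rule summable_on_cong_neutral[THEN iffD1, of _ "{..<N}"]) (auto intro: summable_on_finite)
  then have "sob_terms s r (basis_comb N c) summable_on UNIV"
    using summable_on_reindex_bij_betw[OF e, of "sob_terms s r (basis_comb N c)"] by simp
  with L2 show H: "basis_comb N c \<in> H_space s r" by (simp add: H_space_def)
  have "(\<lambda>l. sob_terms s r (basis_comb N c) (e l)) sums (\<Sum>k<N. (cmod (c k))\<^sup>2)"
    unfolding terms using sums_If_finite_set[of "{..<N}" "\<lambda>l. (cmod (c l))\<^sup>2"] by simp
  then have "(H_norm s r (basis_comb N c))\<^sup>2 = (\<Sum>k<N. (cmod (c k))\<^sup>2)"
    using H_norm_sums[OF H e] sums_unique2 by blast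
  moreover have "H_norm s r (basis_comb N c) \<ge> 0" by (simp add: H_norm_def infsum_nonneg sob_terms_def)
  ultimately show "H_norm s r (basis_comb N c) = sqrt (\<Sum>k<N. (cmod (c k))\<^sup>2)"
    by (metis real_sqrt_unique)
qed

text \<open>The finite case compares two evaluations of the summed squared L2 norms of the
  \<open>T k\<close>: at least the volume times a Frobenius distance, by Bessel, and at most the
  volume times \<open>D\<^sup>2\<close>, by the pointwise bound.\<close>

lemma diff_op_norm_ge:
  fixes A :: "(real ^ 'd \<Rightarrow> complex) \<Rightarrow> real ^ 'd \<Rightarrow> complex"
  assumes anti: "antimono \<sigma>" and summ: "summable (\<lambda>j. (\<sigma> j)\<^sup>2)" and A: "admissible_op s r (Suc n) A"
  shows "ereal (sqrt (\<Sum>j. (\<sigma> (j + n))\<^sup>2)) \<le> diff_op_norm s r A"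
proof (cases "diff_op_norm s r A")
  case PInf
  then show ?thesis by simp
next
  case MInf
  \<comment> \<open>The zero function belongs to the unit ball, so the supremum is not over an empty
    set.\<close>
  have "Linf_norm (\<lambda>x. basis_comb 0 (\<lambda>_. 0) x - A (basis_comb 0 (\<lambda>_. 0)) x) \<le> diff_op_norm s r A"
    unfolding diff_op_norm_def by (rule SUP_upper) (simp add: basis_comb_H_space)
  then have "0 \<le> diff_op_norm s r A" using Linf_norm_nonneg order_trans by blast
  then show ?thesis using MInf by simp
next
  case (real D)
  have AL: "A f \<in> Linf_torus" if "f \<in> H_space s r" for f using A that by (simp add: admissible_op_def)
  have lin: "AE x in lebesgue_on torus. A (\<lambda>y. a * f y + b * g y) x = a * A f x + b * A g x"
    if "f \<in> H_space s r" "g \<in> H_space s r" for f g a b using A that by (simp add: admissible_op_def)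
  obtain m G where m: "m < Suc n" and GL: "\<And>j. j < m \<Longrightarrow> G j \<in> Linf_torus"
    and rank: "\<And>f. f \<in> H_space s r \<Longrightarrow> \<exists>c. AE x in lebesgue_on torus. A f x = (\<Sum>j<m. c j * G j x)"
    using A unfolding admissible_op_def by blast
  define u where "u k x = complex_of_real (\<sigma> k) * character (e k) x" for k and x :: "real ^ 'd"
  have u_comb: "u k = basis_comb (Suc k) (\<lambda>i. if i = k then 1 else 0)" for k
    by (auto simp: u_def basis_comb_def fun_eq_iff)
  have uH: "u k \<in> H_space s r" for k unfolding u_comb by (rule basis_comb_H_space)
  define T where "T k x = u k x - A (u k) x" for k x
  have le1: "AE x in lebesgue_on torus. cmod (f x - A f x) \<le> D" if "f \<in> H_space s r" "H_norm s r f \<le> 1" for f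
  proof -
    have "Linf_norm (\<lambda>x. f x - A f x) \<le> ereal D"
      using that unfolding real[symmetric] diff_op_norm_def by (intro SUP_upper) auto
    moreover have "AE x in lebesgue_on torus. ereal (cmod (f x - A f x)) \<le> Linf_norm (\<lambda>x. f x - A f x)"
      unfolding Linf_norm_def by (rule esssup_AE)
    ultimately show ?thesis
      by (auto elim!: eventually_mono) (metis ereal_less_eq(3) order_trans)
  qed
  have D0: "D \<ge> 0"
  proof (rule ccontr)
    assume "\<not> D \<ge> 0"
    have "AE x in lebesgue_on torus. cmod (basis_comb 0 (\<lambda>_. 0) x - A (basis_comb 0 (\<lambda>_. 0)) x) \<le> D"
      by (rule le1) (simp_all add: basis_comb_H_space)
    then have "AE x in lebesgue_on (torus :: (real ^ 'd) set). False"
      by eventually_elim (use \<open>\<not> D \<ge> 0\<close> in \<open>smt (verit) norm_ge_zero\<close>)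
    then show False using not_AE_False_torus by blast
  qed
  have A_comb: "AE x in lebesgue_on torus. A (basis_comb N c) x = (\<Sum>k<N. c k * A (u k) x)" for N c
  proof (induction N)
    case 0
    \<comment> \<open>The empty combination is the zero function; linearity with both scalars 0
      shows that its image vanishes almost everywhere.\<close>
    show ?case using lin[OF uH uH, of 0 0 0 0] by (simp add: basis_comb_def[abs_def])
  next
    case (Suc N)
    have eq: "basis_comb (Suc N) c = (\<lambda>y. 1 * basis_comb N c y + c N * u N y)"
      by (simp add: basis_comb_def fun_eq_iff u_def)
    show ?case
      using lin[OF basis_comb_H_space(1)[of N c] uH[of N], of 1 "c N"] Suc.IH unfolding eq
      by eventually_elim simp
  qed
  have T_le: "AE x in lebesgue_on torus. cmod (\<Sum>k<N. c k * T k x) \<le> D * sqrt (\<Sum>k<N. (cmod (c k))\<^sup>2)" for N c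
  proof (cases "(\<Sum>k<N. (cmod (c k))\<^sup>2) = 0")
    case True
    then have "\<forall>k<N. c k = 0" by (simp add: sum_nonneg_eq_0_iff)
    then show ?thesis using True by simp
  next
    case False
    define R where "R = sqrt (\<Sum>k<N. (cmod (c k))\<^sup>2)"
    have R: "R > 0" using False sum_nonneg[of "{..<N}" "\<lambda>k. (cmod (c k))\<^sup>2"] by (simp add: R_def less_le)
    \<comment> \<open>Scaling to Euclidean norm 1 puts the combination into the unit ball, where the
      bound \<open>D\<close> applies.\<close>
    define c' where "c' k = c k / complex_of_real R" for k
    have "(\<Sum>k<N. (cmod (c' k))\<^sup>2) = R\<^sup>2 / R\<^sup>2"
      by (simp add: c'_def norm_divide power_divide sum_divide_distrib[symmetric] R_def sum_nonneg)
    then have n1: "H_norm s r (basis_comb N c') \<le> 1" using R by (simp add: basis_comb_H_space)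
    show ?thesis
      using le1[OF basis_comb_H_space(1) n1] A_comb[of N c']
    proof eventually_elim
      case (elim x)
      have "basis_comb N c' x - A (basis_comb N c') x = (\<Sum>k<N. c' k * T k x)"
        by (simp add: elim(2) basis_comb_def T_def u_def right_diff_distrib sum_subtractf)
      also have "\<dots> = (\<Sum>k<N. c k * T k x) / complex_of_real R"
        by (simp add: c'_def sum_divide_distrib)
      finally have "cmod (\<Sum>k<N. c k * T k x) / R \<le> D" using elim(1) R by (simp add: norm_divide)
      then show ?case using R by (simp add: R_def[symmetric] pos_divide_le_eq)
    qed
  qed
  have Tm: "T k \<in> borel_measurable (lebesgue_on torus)" for k
    using AL[OF uH[of k]] H_space_integrable[OF uH[of k]]
    unfolding T_def[abs_def] Linf_torus_def by (intro borel_measurable_diff) auto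
  have Tb: "AE x in lebesgue_on torus. cmod (T k x) \<le> D" for k
    unfolding T_def u_comb by (rule le1) (simp_all add: basis_comb_H_space if_distrib sum.delta cong: if_cong)
  have Gm: "G j \<in> borel_measurable (lebesgue_on torus)" if "j < m" for j using GL[OF that] by (simp add: Linf_torus_def)
  have Gi: "integrable (lebesgue_on torus) (G j)" if "j < m" for j
    using Linf_torus_bounded[OF GL[OF that]] integrable_bounded_torus[OF Gm[OF that]] by blast
  obtain c where c: "\<And>k. AE x in lebesgue_on torus. A (u k) x = (\<Sum>j<m. c k j * G j x)"
    using rank[OF uH] by metis
  \<comment> \<open>The matrix of Fourier coefficients is the diagonal matrix of
    \<open>\<sigma>\<close> minus a product with inner dimension \<open>m\<close>, because a single
    family \<open>G\<close> serves all \<open>k\<close>.\<close>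
  have FT: "fourier_coeff (T k) (e l)
      = (if k = l then complex_of_real (\<sigma> k) else 0) - (\<Sum>j<m. c k j * fourier_coeff (G j) (e l))" for k l
  proof -
    have Ai: "integrable (lebesgue_on torus) (A (u k))"
      using Linf_torus_bounded[OF AL[OF uH]] integrable_bounded_torus AL[OF uH] unfolding Linf_torus_def by blast
    have "fourier_coeff (A (u k)) (e l) = fourier_coeff (\<lambda>x. \<Sum>j<m. c k j * G j x) (e l)"
      using Ai c Gm by (intro fourier_coeff_cong_AE borel_measurable_sum borel_measurable_times) auto
    also have "\<dots> = (\<Sum>j<m. c k j * fourier_coeff (G j) (e l))" using Gi by (intro fourier_coeff_sum) auto
    finally have 1: "fourier_coeff (A (u k)) (e l) = (\<Sum>j<m. c k j * fourier_coeff (G j) (e l))" .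
    have "T k = (\<lambda>y. 1 * u k y + (- 1) * A (u k) y)" by (auto simp: T_def)
    then have "fourier_coeff (T k) (e l) = fourier_coeff (u k) (e l) - fourier_coeff (A (u k)) (e l)"
      using fourier_coeff_linear[OF H_space_integrable[OF uH[of k]] Ai, of 1 "- 1" "e l"] by simp
    also have "fourier_coeff (u k) (e l) = (if k = l then complex_of_real (\<sigma> k) else 0)"
      unfolding u_comb fourier_coeff_basis_comb by auto
    finally show ?thesis using 1 by simp
  qed
  \<comment> \<open>The volume of the torus; it appears on both sides of the estimate below and
    cancels.\<close>
  define V where "V = (2 * pi) ^ CARD('d)"
  have V: "V > 0" by (simp add: V_def)
  have part: "(\<Sum>k\<in>{m..<N}. (\<sigma> k)\<^sup>2) \<le> D\<^sup>2" for N
  proof -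
    have T2i: "integrable (lebesgue_on torus) (\<lambda>x. (cmod (T k x))\<^sup>2)" for k
      by (rule finite_measure.integrable_const_bound[OF finite_measure_torus, where B = "D\<^sup>2"])
        (use Tm[of k] Tb[of k] in \<open>auto elim!: eventually_mono intro: power_mono\<close>)
    have bes: "V * (\<Sum>l<N. (cmod (fourier_coeff (T k) (e l)))\<^sup>2) \<le> (LINT x | lebesgue_on torus. (cmod (T k x))\<^sup>2)" for k
    proof -
      have "inj_on e {..<N}" using e by (auto simp: bij_def inj_on_def)
      then show ?thesis
        using bessel_torus[OF Tm Tb, of "e ` {..<N}" k] by (simp add: sum.reindex V_def)
    qed
    have "V * (\<Sum>k\<in>{m..<N}. (\<sigma> k)\<^sup>2) \<le> V * (\<Sum>k<N. \<Sum>l<N. (cmod (fourier_coeff (T k) (e l)))\<^sup>2)"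
      unfolding FT using V anti \<sigma>_pos
      by (intro mult_left_mono frobenius_distance_to_rank) (auto intro: less_imp_le)
    also have "\<dots> \<le> (\<Sum>k<N. LINT x | lebesgue_on torus. (cmod (T k x))\<^sup>2)"
      unfolding sum_distrib_left[of V] by (intro sum_mono) (use bes in \<open>simp add: sum_distrib_left\<close>)
    also have "\<dots> = (LINT x | lebesgue_on torus. (\<Sum>k<N. (cmod (T k x))\<^sup>2))"
      using T2i by (subst Bochner_Integration.integral_sum) auto
    also have "\<dots> \<le> (LINT x | lebesgue_on (torus :: (real ^ 'd) set). D\<^sup>2)"
      using T2i sum_squares_AE_le[OF D0 T_le] finite_measure.integrable_const[OF finite_measure_torus]
      by (intro integral_mono_AE) auto
    also have "\<dots> = V * D\<^sup>2"
    proof -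
      have "complex_of_real (measure (lebesgue_on (torus :: (real ^ 'd) set)) torus) = complex_of_real V"
        using integral_character[of "0 :: int ^ 'd"] by (simp add: V_def scaleR_conv_of_real)
      then have "measure (lebesgue_on (torus :: (real ^ 'd) set)) torus = V" by (simp only: of_real_eq_iff)
      then show ?thesis by simp
    qed
    finally show ?thesis using V by simp
  qed
  have "(\<Sum>j<N. (\<sigma> (j + n))\<^sup>2) \<le> D\<^sup>2" for N
  proof -
    have "(\<Sum>j<N. (\<sigma> (j + n))\<^sup>2) = (\<Sum>k\<in>{n..<N + n}. (\<sigma> k)\<^sup>2)"
      using sum.shift_bounds_nat_ivl[of "\<lambda>k. (\<sigma> k)\<^sup>2" 0 n N] by (simp add: lessThan_atLeast0)
    \<comment> \<open>The rank bound m < Suc n gives m <= n, so the tail from \<open>m\<close>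
      contains the one from \<open>n\<close>.\<close>
    also have "\<dots> \<le> (\<Sum>k\<in>{m..<N + n}. (\<sigma> k)\<^sup>2)" using m by (intro sum_mono2) auto
    finally show ?thesis using part order_trans by blast
  qed
  then have "(\<Sum>j. (\<sigma> (j + n))\<^sup>2) \<le> D\<^sup>2"
    using summ summable_iff_shift[of "\<lambda>j. (\<sigma> j)\<^sup>2" n] by (intro suminf_le_const) auto
  then have "sqrt (\<Sum>j. (\<sigma> (j + n))\<^sup>2) \<le> sqrt (D\<^sup>2)" by (rule real_sqrt_le_mono)
  then show ?thesis using D0 real by simp
qed

lemma approx_num_ge:
  assumes "antimono \<sigma>" "summable (\<lambda>j. (\<sigma> j)\<^sup>2)"
  shows "ereal (sqrt (\<Sum>j. (\<sigma> (j + n))\<^sup>2)) \<le> approx_num TYPE('d) s r (Suc n)"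
  unfolding approx_num_def using diff_op_norm_ge[OF assms] by (intro INF_greatest) auto

end

text \<open>An exact value for each index; the asymptotics enter only through the tails. Since s >
  0, an enumeration sorted for the weight with s = 1 makes the reciprocal weights of order
  \<open>s\<close> decrease.\<close>

lemma approx_num_eq:
  fixes e :: "nat \<Rightarrow> int ^ 'd"
  assumes s: "s > real CARD('d) / 2" and r: "0 < r"
    and e: "bij e" and mono: "incseq (\<lambda>j. sob_weight 1 r (e j))"
  shows "approx_num TYPE('d) s r (Suc n) = ereal (sqrt (\<Sum>j. (1 / sob_weight s r (e (j + n)))\<^sup>2))"
proof -
  define \<sigma> where "\<sigma> j = 1 / sob_weight s r (e j)" for j
  have summ: "summable (\<lambda>j. (\<sigma> j)\<^sup>2)" using sorted_sob_weight_tail(1)[OF s r e mono] by (simp add: \<sigma>_def)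
  have "0 < real CARD('d) / 2" by simp
  with s have s0: "s > 0" by linarith
  have anti: "antimono \<sigma>"
  proof (rule antimonoI)
    fix i j :: nat assume "i \<le> j"
    then have "sob_weight 1 r (e i) powr s \<le> sob_weight 1 r (e j) powr s"
      using s0 incseqD[OF mono, of i j] sob_weight_pos[OF r, of 1 "e i"] by (intro powr_mono2) auto
    then have "sob_weight s r (e i) \<le> sob_weight s r (e j)" by (simp add: sob_weight_powr[OF r, of s])
    then show "\<sigma> j \<le> \<sigma> i"
      using sob_weight_pos[OF r, of s "e i"] by (simp add: \<sigma>_def frac_le)
  qed
  show ?thesis
    using approx_num_le[OF r e summ \<sigma>_def, of n] approx_num_ge[OF r e \<sigma>_def anti summ, of n]
    by (simp add: \<sigma>_def)
qed

theorem theorem3: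
  fixes s :: real and r :: ereal
  assumes "s > real CARD('d) / 2" and "0 < r"
  shows "(\<lambda>n. ereal (real n powr (s / real CARD('d) - 1 / 2)) * approx_num TYPE('d::finite) s r n)
     \<longlonglongrightarrow> ereal (sqrt (real CARD('d) / (2 * s - real CARD('d))) *
                 measure lborel (unit_ball_r r :: (real ^ 'd) set) powr (s / real CARD('d)))"
proof -
  \<comment> \<open>Constant vectors embed the integers, so the lattice is infinite and can be
    enumerated by all naturals.\<close>
  have "inj (\<lambda>m :: int. (\<chi> i. m) :: int ^ 'd)" by (auto simp: inj_on_def vec_eq_iff)
  then have "infinite (UNIV :: (int ^ 'd) set)"
    using infinite_UNIV_int finite_imageD finite_subset[OF subset_UNIV] by blast
  then obtain e :: "nat \<Rightarrow> int ^ 'd" where e: "bij e" "incseq (\<lambda>j. sob_weight 1 r (e j))"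
    using exists_sorted_enumeration[of "sob_weight 1 r"] finite_sob_weight_le[OF assms(2)] by metis
  show ?thesis
  \<comment> \<open>The exact formula covers indices \<open>Suc n\<close> only; index 0 admits no
    operator at all, as no rank is below 0.\<close>
  proof (rule LIMSEQ_imp_Suc)
    show "(\<lambda>n. ereal (real (Suc n) powr (s / real CARD('d) - 1 / 2)) * approx_num TYPE('d) s r (Suc n))
      \<longlonglongrightarrow> ereal (sqrt (real CARD('d) / (2 * s - real CARD('d))) *
                 measure lborel (unit_ball_r r :: (real ^ 'd) set) powr (s / real CARD('d)))"
      unfolding approx_num_eq[OF assms e] times_ereal.simps(1) lim_ereal
      by (rule sorted_sob_weight_tail(2)[OF assms e])
  qed
qed

end
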